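(* Let $n\ge1$ be an integer and regard $L_n^{(1)}$ as an $\Re$-module via $\sharp$. Then: (i) if $n$ is odd, $L_n^{(1)}$ is isomorphic to the irreducible $\Re$-module $R_{\frac{n-1}{2}}(-\frac14,-\frac14,-\frac14)$; (ii) if $n=2$, $L_n^{(1)}$ is isomorphic to the irreducible $\Re$-module $R_0(0,-\frac12,0)$; (iii) if $n\neq2$ and $n\equiv2\pmod4$, $L_n^{(1)}$ is isomorphic to the direct sum of the irreducible $\Re$-modules $R_{\frac{n-6}{4}}(\frac{n-2}{8},\frac{n-2}{8},\frac{n-2}{8})$ and $R_{\frac{n-2}{4}}(\frac{n-2}{8},\frac{n-6}{8},\frac{n-2}{8})$; (iv) if $n\equiv0\pmod4$, $L_n^{(1)}$ is isomorphic to the direct sum of the irreducible $\Re$-modules $R_{\frac n4-1}(\frac n8,\frac{n-4}{8},\frac{n-4}{8})$ and $R_{\frac n4-1}(\frac{n-4}{8},\frac{n-4}{8},\frac n8)$.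
   Context: $U(\mathfrak{sl}_2)$ is the $\mathbb C$-algebra generated by $E,F,H$ with $[H,E]=2E$, $[H,F]=-2F$, $[E,F]=H$. For $n\in\mathbb N$, $L_n$ is the $(n+1)$-dimensional $U(\mathfrak{sl}_2)$-module with basis $v_0,\dots,v_n$ such that $Ev_i=(n-i+1)v_{i-1}$ ($1\le i\le n$), $Ev_0=0$, $Fv_i=(i+1)v_{i+1}$ ($0\le i\le n-1$), $Fv_n=0$, $Hv_i=(n-2i)v_i$. Let $L_n^{(0)}=\mathrm{span}\{v_i: i \text{ even}\}$ and (for $n\ge1$) $L_n^{(1)}=\mathrm{span}\{v_i: i\text{ odd}\}$. $\Re$ is generated by $A,B,C,\Delta$ with $[A,B]=[B,C]=[C,A]=2\Delta$ and $\alpha=[A,\Delta]+AC-BA$, $\beta=[B,\Delta]+BA-CB$, $\gamma=[C,\Delta]+CB-AC$ central; $\delta=A+B+C$. $\sharp:\Re\to U(\mathfrak{sl}_2)$ is the algebra homomorphism with $A\mapsto \frac{(E+F-2)(E+F+2)}{16}$, $B\mapsto\frac{(H-2)(H+2)}{16}$, $C\mapsto\frac{(\mathbf iE-\mathbf iF-2)(\mathbf iE-\mathbf iF+2)}{16}$, $\Delta\mapsto\frac{(H+2)F^2-(H-2)E^2}{64}$ ($\mathbf i=\sqrt{-1}$); its image preserves $L_n^{(0)}$ and $L_n^{(1)}$, making them $\Re$-modules. For $a,b,c\in\mathbb C$, $d\in\mathbb N$, $R_d(a,b,c)$ is the $(d+1)$-dimensional $\Re$-module (determined up to isomorphism) with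 a basis in which $A$ is lower bidiagonal with diagonal $\theta_i=(a+\frac d2-i)(a+\frac d2-i+1)$ and subdiagonal entries $1$, $B$ is upper bidiagonal with diagonal $\theta^*_i=(b+\frac d2-i)(b+\frac d2-i+1)$ and superdiagonal $\varphi_i=i(i-d-1)(a+b+c+\frac d2-i+2)(a+b-c+\frac d2-i+1)$, and $\alpha,\beta,\gamma,\delta$ act as the scalars $(c-b)(c+b+1)(a-\frac d2)(a+\frac d2+1)$, $(a-c)(a+c+1)(b-\frac d2)(b+\frac d2+1)$, $(b-a)(b+a+1)(c-\frac d2)(c+\frac d2+1)$, $\frac d2(\frac d2+1)+a(a+1)+b(b+1)+c(c+1)$. *)

theory Defs
  imports Complex_Main "Jordan_Normal_Form.Matrix"
begin

datatype rgen = GA | GB | GC | GD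

(* A finite-dimensional representation of the Racah algebra: dimension k together
   with the k x k matrices by which the generators A, B, C, Delta act
   (w.r.t. a chosen basis). *)
type_synonym rmod = "nat \<times> (rgen \<Rightarrow> complex mat)"

definition rmod_iso :: "rmod \<Rightarrow> rmod \<Rightarrow> bool" where
  "rmod_iso M N \<longleftrightarrow> fst M = fst N \<and>
     (\<exists>P \<in> carrier_mat (fst M) (fst M). invertible_mat P \<and>
        (\<forall>g. P * snd M g = snd N g * P))"

definition rmod_invariant :: "rmod \<Rightarrow> complex vec set \<Rightarrow> bool" where
  "rmod_invariant M W \<longleftrightarrow> W \<subseteq> carrier_vec (fst M) \<and> 0\<^sub>v (fst M) \<in> W \<and>
     (\<forall>v\<in>W. \<forall>w\<in>W. v + w \<in> W) \<and> (\<forall>c. \<forall>v\<in>W. c \<cdot>\<^sub>v v \<in> W) \<and>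
     (\<forall>g. \<forall>v\<in>W. snd M g *\<^sub>v v \<in> W)"

definition rmod_irreducible :: "rmod \<Rightarrow> bool" where
  "rmod_irreducible M \<longleftrightarrow> fst M > 0 \<and>
     (\<forall>W. rmod_invariant M W \<longrightarrow> W = {0\<^sub>v (fst M)} \<or> W = carrier_vec (fst M))"

definition rmod_dsum :: "rmod \<Rightarrow> rmod \<Rightarrow> rmod" where
  "rmod_dsum M N = (fst M + fst N,
     \<lambda>g. four_block_mat (snd M g) (0\<^sub>m (fst M) (fst N)) (0\<^sub>m (fst N) (fst M)) (snd N g))"

(* ---- The sl2-module L_n, basis v_0..v_n (index i = v_i) ---- *)
definition sl2E :: "nat \<Rightarrow> complex mat" where
  "sl2E n = mat (n+1) (n+1) (\<lambda>(r,c). if 1 \<le> c \<and> r + 1 = c then of_nat (n - c + 1) else 0)"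

definition sl2F :: "nat \<Rightarrow> complex mat" where
  "sl2F n = mat (n+1) (n+1) (\<lambda>(r,c). if c < n \<and> r = c + 1 then of_nat (c + 1) else 0)"

definition sl2H :: "nat \<Rightarrow> complex mat" where
  "sl2H n = mat (n+1) (n+1) (\<lambda>(r,c). if r = c then of_int (int n - 2 * int c) else 0)"

definition sharpA :: "nat \<Rightarrow> complex mat" where
  "sharpA n = (let I = 1\<^sub>m (n+1); X = sl2E n + sl2F n in
     (1/16) \<cdot>\<^sub>m ((X - 2 \<cdot>\<^sub>m I) * (X + 2 \<cdot>\<^sub>m I)))"

definition sharpB :: "nat \<Rightarrow> complex mat" where
  "sharpB n = (let I = 1\<^sub>m (n+1); X = sl2H n in
     (1/16) \<cdot>\<^sub>m ((X - 2 \<cdot>\<^sub>m I) * (X + 2 \<cdot>\<^sub>m I)))"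

definition sharpC :: "nat \<Rightarrow> complex mat" where
  "sharpC n = (let I = 1\<^sub>m (n+1); X = \<i> \<cdot>\<^sub>m sl2E n - \<i> \<cdot>\<^sub>m sl2F n in
     (1/16) \<cdot>\<^sub>m ((X - 2 \<cdot>\<^sub>m I) * (X + 2 \<cdot>\<^sub>m I)))"

definition sharpD :: "nat \<Rightarrow> complex mat" where
  "sharpD n = (let I = 1\<^sub>m (n+1); E = sl2E n; F = sl2F n; H = sl2H n in
     (1/64) \<cdot>\<^sub>m ((H + 2 \<cdot>\<^sub>m I) * (F * F) - (H - 2 \<cdot>\<^sub>m I) * (E * E)))"

definition sharp_gen :: "nat \<Rightarrow> rgen \<Rightarrow> complex mat" where
  "sharp_gen n g = (case g of GA \<Rightarrow> sharpA n | GB \<Rightarrow> sharpB n | GC \<Rightarrow> sharpC n | GD \<Rightarrow> sharpD n)"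

(* L_n^(1): span of v_i, i odd; basis v_1, v_3, ..., i.e. index j stands for v_(2j+1).
   Its dimension is the number of odd i in {0..n}, namely (n+1) div 2.
   The action is the restriction (the images of sharp preserve this span). *)
definition Lodd :: "nat \<Rightarrow> rmod" where
  "Lodd n = ((n+1) div 2,
     \<lambda>g. mat ((n+1) div 2) ((n+1) div 2) (\<lambda>(r,c). sharp_gen n g $$ (2*r+1, 2*c+1)))"

definition Rtheta :: "nat \<Rightarrow> complex \<Rightarrow> nat \<Rightarrow> complex" where
  "Rtheta d a i = (a + of_nat d / 2 - of_nat i) * (a + of_nat d / 2 - of_nat i + 1)"

definition Rphi :: "nat \<Rightarrow> complex \<Rightarrow> complex \<Rightarrow> complex \<Rightarrow> nat \<Rightarrow> complex" where
  "Rphi d a b c i = of_nat i * (of_nat i - of_nat d - 1) * (a + b + c + of_nat d / 2 - of_nat i + 2)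
      * (a + b - c + of_nat d / 2 - of_nat i + 1)"

definition Rdelta :: "nat \<Rightarrow> complex \<Rightarrow> complex \<Rightarrow> complex \<Rightarrow> complex" where
  "Rdelta d a b c = (of_nat d / 2) * (of_nat d / 2 + 1) + a * (a + 1) + b * (b + 1) + c * (c + 1)"

definition RmatA :: "nat \<Rightarrow> complex \<Rightarrow> complex mat" where
  "RmatA d a = mat (d+1) (d+1) (\<lambda>(r,c). if r = c then Rtheta d a r else if r = c + 1 then 1 else 0)"

definition RmatB :: "nat \<Rightarrow> complex \<Rightarrow> complex \<Rightarrow> complex \<Rightarrow> complex mat" where
  "RmatB d a b c = mat (d+1) (d+1) (\<lambda>(r,s). if r = s then Rtheta d b r
       else if s = r + 1 then Rphi d a b c s else 0)"

(* C is determined by delta = A + B + C acting as a scalar;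
   Delta is determined by [A,B] = 2 Delta. *)
definition Rmod :: "nat \<Rightarrow> complex \<Rightarrow> complex \<Rightarrow> complex \<Rightarrow> rmod" where
  "Rmod d a b c = (d + 1, (let A = RmatA d a; B = RmatB d a b c in
     (\<lambda>g. case g of GA \<Rightarrow> A | GB \<Rightarrow> B
        | GC \<Rightarrow> Rdelta d a b c \<cdot>\<^sub>m 1\<^sub>m (d+1) - A - B
        | GD \<Rightarrow> (1/2) \<cdot>\<^sub>m (A * B - B * A))))"

end

theory Submission
  imports Defs "Jordan_Normal_Form.Determinant"
begin

text \<open>Since \<open>\<delta> = A + B + C\<close> acts as a scalar and \<open>2\<Delta> = [A,B]\<close>, an isomorphism only has to intertwine \<open>A\<close> and
  \<open>B\<close>. On the basis of the odd \<open>v\<^sub>i\<close>, \<open>B\<close> is diagonal and \<open>A\<close> tridiagonal. For odd \<open>n\<close> the eigenvalues of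
  \<open>B\<close> are distinct. For even \<open>n\<close> the flip \<open>v\<^sub>i \<mapsto> v\<^bsub>n-i\<^esub>\<close> commutes with the action, and on each of its two
  eigenspaces \<open>B\<close> again has distinct eigenvalues while \<open>A\<close> stays tridiagonal.

  A pair (tridiagonal with nonzero off-diagonal entries, diagonal with distinct entries) is irreducible
  and determined up to isomorphism by the diagonal entries and the products of opposite
  off-diagonal entries. The transition to the bidiagonal form of \<open>R\<^sub>d(a,b,c)\<close> is given by an explicit
  triangular matrix, whose entries are forced by \<open>B\<close>; that it intertwines \<open>A\<close> is an interpolation identity
  for the quartic \<open>\<phi>\<close>.\<close>

section \<open>Isomorphisms and direct sums\<close>

text \<open>Put m = 2b + d + 1. Completing the square turns the i-th eigenvalue of B on R_d(a,b,c)
  into (m/2 - i)^2 - 1/4, so the nodes i and m - i share an eigenvalue. This reflection shapes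
  everything. It is why the off-diagonal products of A in an eigenbasis of B contain \<phi> at m -
  j, a point that need not be an index, and why all denominators are factors m - i - j. On the odd
  part of L_n the eigenvalues of B are of the same form with m = n/2 - 1. For even n this m is an
  integer and the reflection is the flip itself; each flip eigenspace keeps the nodes up to the
  centre, which puts the model at the border of degeneracy: m is 2d, 2d + 1 or 2d + 2. For odd n the
  number m is a half-integer and no denominator vanishes. Matching the eigenvalues of B fixes
  b.\<close>

definition rmod_wf :: "rmod \<Rightarrow> bool" where
  "rmod_wf M \<longleftrightarrow> (\<forall>g. snd M g \<in> carrier_mat (fst M) (fst M))"

text \<open>The columns of \<open>S\<close> are the new basis vectors in the old coordinates, which
  is the form in which every isomorphism below is found; \<open>rmod_iso\<close> asks for the
  opposite direction. As the matrices are square, a one-sided inverse suffices.\<close>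

lemma rmod_isoI:
  assumes wf: "rmod_wf M" "rmod_wf N" and dim: "fst M = k" "fst N = k"
    and P: "P \<in> carrier_mat k k" and S: "S \<in> carrier_mat k k" and PS: "P * S = 1\<^sub>m k"
    and int: "\<And>g. snd M g * S = S * snd N g"
  shows "rmod_iso M N"
proof -
  have SP: "S * P = 1\<^sub>m k" using mat_mult_left_right_inverse[OF P S PS] .
  have "P * snd M g = snd N g * P" for g
  proof -
    have M: "snd M g \<in> carrier_mat k k" and N: "snd N g \<in> carrier_mat k k"
      using wf dim by (auto simp: rmod_wf_def)
    have "P * snd M g = P * (snd M g * (S * P))" using M P by (simp add: SP)
    also have "\<dots> = P * ((snd M g * S) * P)" using M S P by simp
    also have "\<dots> = (P * S) * (snd N g * P)"
      using M N S P by (simp add: int assoc_mult_mat[of _ k k _ k _ k] mult_carrier_mat[of _ k k _ k])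
    finally show ?thesis using N P by (simp add: PS)
  qed
  moreover have "invertible_mat P"
    unfolding invertible_mat_def inverts_mat_def using P S PS SP by auto
  ultimately show ?thesis unfolding rmod_iso_def using dim P by auto
qed

lemma rmod_isoE:
  assumes "rmod_iso M N" "rmod_wf M" "rmod_wf N"
  obtains k P S where "fst M = k" "fst N = k" "P \<in> carrier_mat k k" "S \<in> carrier_mat k k"
    "P * S = 1\<^sub>m k" "S * P = 1\<^sub>m k" "\<And>g. P * snd M g = snd N g * P"
    "\<And>g. snd M g * S = S * snd N g"
proof -
  obtain P where P: "P \<in> carrier_mat (fst M) (fst M)" "invertible_mat P" and eq: "fst M = fst N"
    and int: "\<And>g. P * snd M g = snd N g * P"
    using assms(1) unfolding rmod_iso_def by auto
  obtain S where S: "P * S = 1\<^sub>m (fst M)" "S * P = 1\<^sub>m (dim_row S)"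
    using P unfolding invertible_mat_def inverts_mat_def by auto
  have S': "S \<in> carrier_mat (fst M) (fst M)"
    using arg_cong[OF S(1), of dim_col] arg_cong[OF S(2), of dim_col] P by auto
  have SP: "S * P = 1\<^sub>m (fst M)" using S(2) S' by simp
  have int': "snd M g * S = S * snd N g" for g
  proof -
    have M: "snd M g \<in> carrier_mat (fst M) (fst M)" and N: "snd N g \<in> carrier_mat (fst M) (fst M)"
      using assms eq by (auto simp: rmod_wf_def)
    note assoc = assoc_mult_mat[of _ "fst M" "fst M" _ "fst M" _ "fst M"]
    have "snd M g * S = (S * P) * (snd M g * S)" using M S' S by simp
    also have "\<dots> = S * ((P * snd M g) * S)"
      using M S' P(1) by (simp add: assoc mult_carrier_mat[of _ "fst M" "fst M" _ "fst M"])
    also have "\<dots> = S * (snd N g * (P * S))" using M N S' P by (simp add: int assoc)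
    finally show ?thesis using N by (simp add: S)
  qed
  show ?thesis by (rule that[OF refl eq[symmetric] P(1) S' S(1) SP int int'])
qed

lemma rmod_iso_trans:
  assumes "rmod_iso M N" "rmod_iso N K" "rmod_wf M" "rmod_wf N" "rmod_wf K"
  shows "rmod_iso M K"
proof -
  obtain k P S where 1: "fst M = k" "fst N = k" "P \<in> carrier_mat k k" "S \<in> carrier_mat k k"
    "P * S = 1\<^sub>m k" "\<And>g. snd M g * S = S * snd N g"
    using rmod_isoE[OF assms(1,3,4)] by metis
  obtain l P' S' where 2: "fst N = l" "fst K = l" "P' \<in> carrier_mat l l" "S' \<in> carrier_mat l l"
    "P' * S' = 1\<^sub>m l" "\<And>g. snd N g * S' = S' * snd K g"
    using rmod_isoE[OF assms(2,4,5)] by metis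
  have l: "l = k" using 1 2 by simp
  note 2 = 2[unfolded l]
  have car: "snd M g \<in> carrier_mat k k" "snd N g \<in> carrier_mat k k" "snd K g \<in> carrier_mat k k" for g
    using assms(3-5) 1 2 by (auto simp: rmod_wf_def)
  show ?thesis
  proof (rule rmod_isoI[where k=k and P="P' * P" and S="S * S'"])
    have "P' * P * (S * S') = P' * ((P * S) * S')"
      using 1(3,4) 2(3,4) by (simp add: assoc_mult_mat[of _ k k _ k _ k] mult_carrier_mat[of _ k k _ k])
    then show "P' * P * (S * S') = 1\<^sub>m k" using 1 2 by simp
    fix g
    have "snd M g * (S * S') = S * (snd N g * S')"
      using 1(3,4) 2(3,4) car[of g] by (simp add: 1(6) flip: assoc_mult_mat)
    then show "snd M g * (S * S') = S * S' * snd K g"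
      using 1(3,4) 2(3,4) car[of g] by (simp add: 2(6))
  qed (use assms 1 2 in auto)
qed

lemma rmod_wf_dsum: "rmod_wf M \<Longrightarrow> rmod_wf N \<Longrightarrow> rmod_wf (rmod_dsum M N)"
  unfolding rmod_wf_def rmod_dsum_def by simp

lemma rmod_iso_dsum:
  assumes "rmod_iso M M'" "rmod_iso N N'" "rmod_wf M" "rmod_wf M'" "rmod_wf N" "rmod_wf N'"
  shows "rmod_iso (rmod_dsum M N) (rmod_dsum M' N')"
proof -
  obtain k P S where 1: "fst M = k" "fst M' = k" "P \<in> carrier_mat k k" "S \<in> carrier_mat k k"
    "P * S = 1\<^sub>m k" "\<And>g. snd M g * S = S * snd M' g"
    using rmod_isoE[OF assms(1,3,4)] by metis
  obtain l P' S' where 2: "fst N = l" "fst N' = l" "P' \<in> carrier_mat l l" "S' \<in> carrier_mat l l"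
    "P' * S' = 1\<^sub>m l" "\<And>g. snd N g * S' = S' * snd N' g"
    using rmod_isoE[OF assms(2,5,6)] by metis
  have car: "snd M g \<in> carrier_mat k k" "snd M' g \<in> carrier_mat k k"
      "snd N g \<in> carrier_mat l l" "snd N' g \<in> carrier_mat l l" for g
    using assms(3-6) 1 2 by (auto simp: rmod_wf_def)
  show ?thesis
  proof (rule rmod_isoI[where k="k+l" and P="four_block_mat P (0\<^sub>m k l) (0\<^sub>m l k) P'"
        and S="four_block_mat S (0\<^sub>m k l) (0\<^sub>m l k) S'"])
    show "four_block_mat P (0\<^sub>m k l) (0\<^sub>m l k) P' * four_block_mat S (0\<^sub>m k l) (0\<^sub>m l k) S' = 1\<^sub>m (k + l)"
      using 1 2 by (subst mult_four_block_mat[of _ k k _ l _ l _ _ k _ l]) auto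
    fix g
    show "snd (rmod_dsum M N) g * four_block_mat S (0\<^sub>m k l) (0\<^sub>m l k) S' =
         four_block_mat S (0\<^sub>m k l) (0\<^sub>m l k) S' * snd (rmod_dsum M' N') g"
      using 1 2 car[of g] unfolding rmod_dsum_def
      by (simp add: mult_four_block_mat[of _ k k _ l _ l _ _ k _ l])
  qed (use assms 1 2 in \<open>auto simp: rmod_wf_dsum\<close>, auto simp: rmod_dsum_def)
qed

text \<open>The preimage under \<open>P\<close> of an invariant subspace of \<open>N\<close> is
  invariant in \<open>M\<close>, hence zero or everything, and invertibility of \<open>P\<close>
  carries this back.\<close>

lemma rmod_irreducible_iso:
  assumes "rmod_iso M N" "rmod_wf M" "rmod_wf N" "rmod_irreducible M"
  shows "rmod_irreducible N"
proof -
  obtain k P S where 1: "fst M = k" "fst N = k" "P \<in> carrier_mat k k" "S \<in> carrier_mat k k"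
    "P * S = 1\<^sub>m k" "\<And>g. P * snd M g = snd N g * P"
    using rmod_isoE[OF assms(1,2,3)] by metis
  have car: "snd M g \<in> carrier_mat k k" "snd N g \<in> carrier_mat k k" for g
    using assms 1 by (auto simp: rmod_wf_def)
  have "W = {0\<^sub>v k} \<or> W = carrier_vec k" if W: "rmod_invariant N W" for W
  proof -
    define W' where "W' = {v \<in> carrier_vec k. P *\<^sub>v v \<in> W}"
    have inW: "S *\<^sub>v w \<in> W'" and PSw: "P *\<^sub>v (S *\<^sub>v w) = w" if "w \<in> W" for w
    proof -
      have w: "w \<in> carrier_vec k" using that W 1 by (auto simp: rmod_invariant_def)
      show 2: "P *\<^sub>v (S *\<^sub>v w) = w"
        using assoc_mult_mat_vec[OF 1(3,4) w] w by (simp add: 1(5))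
      show "S *\<^sub>v w \<in> W'" using that 2 w 1(4) by (auto simp: W'_def)
    qed
    have P0: "P *\<^sub>v 0\<^sub>v k = 0\<^sub>v k" using 1(3) by auto
    have "rmod_invariant M W'"
      unfolding rmod_invariant_def
    proof (intro conjI ballI allI)
      show "W' \<subseteq> carrier_vec (fst M)" using 1 by (auto simp: W'_def)
      show "0\<^sub>v (fst M) \<in> W'" using W 1 P0 by (auto simp: W'_def rmod_invariant_def)
      fix v assume v: "v \<in> W'"
      then have vk: "v \<in> carrier_vec k" and Pv: "P *\<^sub>v v \<in> W" by (auto simp: W'_def)
      show "v + w \<in> W'" if "w \<in> W'" for w
        using that v W 1(3) by (auto simp: W'_def rmod_invariant_def mult_add_distrib_mat_vec)
      show "c \<cdot>\<^sub>v v \<in> W'" for c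
        using v W 1(3) by (auto simp: W'_def rmod_invariant_def mult_mat_vec)
      fix g
      have "P *\<^sub>v (snd M g *\<^sub>v v) = snd N g *\<^sub>v (P *\<^sub>v v)"
        using assoc_mult_mat_vec[OF 1(3) car(1) vk, of g] assoc_mult_mat_vec[OF car(2) 1(3) vk, of g]
        by (simp add: 1(6))
      also have "\<dots> \<in> W" using W Pv by (auto simp: rmod_invariant_def)
      finally show "snd M g *\<^sub>v v \<in> W'" using car(1)[of g] vk by (auto simp: W'_def)
    qed
    then consider "W' = {0\<^sub>v k}" | "W' = carrier_vec k"
      using assms(4) 1 unfolding rmod_irreducible_def by blast
    then show ?thesis
    proof cases
      case 1
      have "w = 0\<^sub>v k" if "w \<in> W" for w
        using inW[OF that] PSw[OF that] 1 P0 by auto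
      moreover have "0\<^sub>v k \<in> W" using W \<open>fst N = k\<close> by (auto simp: rmod_invariant_def)
      ultimately show ?thesis by blast
    next
      case 2
      have "w \<in> W" if "w \<in> carrier_vec k" for w
      proof -
        have "S *\<^sub>v w \<in> W'" unfolding 2 using that 1(4) by simp
        then have "P *\<^sub>v (S *\<^sub>v w) \<in> W" by (auto simp: W'_def)
        then show ?thesis using assoc_mult_mat_vec[OF 1(3,4) that] that by (simp add: 1(5))
      qed
      moreover have "W \<subseteq> carrier_vec k" using W \<open>fst N = k\<close> by (auto simp: rmod_invariant_def)
      ultimately show ?thesis by blast
    qed
  qed
  then show ?thesis using assms(4) 1 by (auto simp: rmod_irreducible_def)
qed

text \<open>A pair of matrices is completed as in \<open>Rmod\<close>, but with the scalar of
  \<delta> as a free parameter. Both \<open>Rmod\<close> and \<open>Lodd\<close> become instances,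
  and comparing them reduces to comparing this scalar and the pairs.\<close>

definition AB_mod :: "nat \<Rightarrow> complex \<Rightarrow> complex mat \<Rightarrow> complex mat \<Rightarrow> rmod" where
  "AB_mod k \<delta> A B = (k, \<lambda>g. case g of GA \<Rightarrow> A | GB \<Rightarrow> B
     | GC \<Rightarrow> \<delta> \<cdot>\<^sub>m 1\<^sub>m k - A - B | GD \<Rightarrow> (1/2) \<cdot>\<^sub>m (A * B - B * A))"

lemma Rmod_eq_AB_mod: "Rmod d a b c = AB_mod (d+1) (Rdelta d a b c) (RmatA d a) (RmatB d a b c)"
  by (simp add: Rmod_def AB_mod_def Let_def)

lemma rmod_wf_AB_mod: "A \<in> carrier_mat k k \<Longrightarrow> B \<in> carrier_mat k k \<Longrightarrow> rmod_wf (AB_mod k \<delta> A B)"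
  unfolding rmod_wf_def AB_mod_def by (simp add: minus_carrier_mat split: rgen.split)

lemma fst_AB_mod: "fst (AB_mod k \<delta> A B) = k"
  by (simp add: AB_mod_def)

text \<open>\<open>S\<close> may be rectangular, because it also serves as the inclusion of a
  summand of a direct sum.\<close>

lemma AB_mod_intertwine:
  assumes A: "A \<in> carrier_mat k k" and B: "B \<in> carrier_mat k k"
    and A': "A' \<in> carrier_mat l l" and B': "B' \<in> carrier_mat l l" and S: "S \<in> carrier_mat k l"
    and int: "A * S = S * A'" "B * S = S * B'"
  shows "snd (AB_mod k \<delta> A B) g * S = S * snd (AB_mod l \<delta> A' B') g"
proof (cases g)
  case GC
  have "(\<delta> \<cdot>\<^sub>m 1\<^sub>m k - A - B) * S = \<delta> \<cdot>\<^sub>m S - A * S - B * S"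
    using A B S by (simp add: minus_mult_distrib_mat[where nr=k and n=k and nc=l] minus_carrier_mat mult_smult_assoc_mat[where nr=k and n=k and nc=l])
  also have "\<dots> = S * (\<delta> \<cdot>\<^sub>m 1\<^sub>m l - A' - B')"
    using A' B' S by (simp add: int mult_minus_distrib_mat[where nr=k and n=l and nc=l] minus_carrier_mat mult_smult_distrib[where nr=k and n=l and nc=l])
  finally show ?thesis using GC by (simp add: AB_mod_def)
next
  case GD
  have "A * B * S = S * (A' * B')"
    using A B A' B' S by (simp add: int) (simp add: int flip: assoc_mult_mat)
  moreover have "B * A * S = S * (B' * A')"
    using A B A' B' S by (simp add: int) (simp add: int flip: assoc_mult_mat)
  ultimately have "((1/2) \<cdot>\<^sub>m (A * B - B * A)) * S = S * ((1/2) \<cdot>\<^sub>m (A' * B' - B' * A'))"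
    using A B A' B' S
    by (simp add: mult_smult_assoc_mat[where nr=k and n=k and nc=l] mult_smult_distrib[where nr=k and n=l and nc=l]
        minus_mult_distrib_mat[where nr=k and n=k and nc=l] mult_minus_distrib_mat[where nr=k and n=l and nc=l] minus_carrier_mat)
  then show ?thesis using GD by (simp add: AB_mod_def)
qed (use int in \<open>auto simp: AB_mod_def\<close>)

lemma AB_mod_isoI:
  assumes "A \<in> carrier_mat k k" "B \<in> carrier_mat k k" "A' \<in> carrier_mat k k" "B' \<in> carrier_mat k k"
    "S \<in> carrier_mat k k" "P \<in> carrier_mat k k" "P * S = 1\<^sub>m k"
    "A * S = S * A'" "B * S = S * B'"
  shows "rmod_iso (AB_mod k \<delta> A B) (AB_mod k \<delta> A' B')"
proof (rule rmod_isoI[where k=k and P=P and S=S])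
  show "snd (AB_mod k \<delta> A B) g * S = S * snd (AB_mod k \<delta> A' B') g" for g
    using assms by (intro AB_mod_intertwine)
qed (use assms(1-7) in \<open>auto intro: rmod_wf_AB_mod simp: fst_AB_mod\<close>)

text \<open>The columns of \<open>U1\<close> and \<open>U2\<close> are bases of two complementary
  invariant subspaces, and the rows of \<open>V1\<close> and \<open>V2\<close> are the dual
  coordinate functionals.\<close>

lemma AB_mod_iso_dsumI:
  assumes A: "A \<in> carrier_mat N N" "B \<in> carrier_mat N N"
    and A1: "A1 \<in> carrier_mat k k" "B1 \<in> carrier_mat k k"
    and A2: "A2 \<in> carrier_mat l l" "B2 \<in> carrier_mat l l" and N: "N = k + l"
    and U: "U1 \<in> carrier_mat N k" "U2 \<in> carrier_mat N l"
    and V: "V1 \<in> carrier_mat k N" "V2 \<in> carrier_mat l N"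
    and inv: "V1 * U1 = 1\<^sub>m k" "V2 * U2 = 1\<^sub>m l" "V1 * U2 = 0\<^sub>m k l" "V2 * U1 = 0\<^sub>m l k"
    and int: "A * U1 = U1 * A1" "B * U1 = U1 * B1" "A * U2 = U2 * A2" "B * U2 = U2 * B2"
  shows "rmod_iso (AB_mod N \<delta> A B) (rmod_dsum (AB_mod k \<delta> A1 B1) (AB_mod l \<delta> A2 B2))"
proof -
  \<comment> \<open>The blocks without rows make this the matrix with \<open>U1\<close> and
    \<open>U2\<close> side by side; in the same way \<open>P\<close> stacks \<open>V1\<close> on
    \<open>V2\<close>.\<close>
  define S where "S = four_block_mat U1 U2 (0\<^sub>m 0 k) (0\<^sub>m 0 l)"
  define P where "P = four_block_mat V1 (0\<^sub>m k 0) V2 (0\<^sub>m l 0)"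
  have S: "S \<in> carrier_mat N N"
    unfolding S_def using four_block_carrier_mat[OF U(1), of "0\<^sub>m 0 l" 0 l] N by simp
  have P: "P \<in> carrier_mat N N"
    unfolding P_def using four_block_carrier_mat[OF V(1), of "0\<^sub>m l 0" l 0] N by simp
  have "P * S = four_block_mat (1\<^sub>m k) (0\<^sub>m k l) (0\<^sub>m l k) (1\<^sub>m l)"
    unfolding P_def S_def using U V
    by (subst mult_four_block_mat[of _ k N _ 0 _ l _ _ k _ l])
      (auto simp: inv)
  then have PS: "P * S = 1\<^sub>m N" using N by simp
  have int': "X * S = S * four_block_mat X1 (0\<^sub>m k l) (0\<^sub>m l k) X2"
    if X: "X \<in> carrier_mat N N" "X1 \<in> carrier_mat k k" "X2 \<in> carrier_mat l l"
      and e: "X * U1 = U1 * X1" "X * U2 = U2 * X2" for X X1 X2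
  proof -
    have "X = four_block_mat X (0\<^sub>m N 0) (0\<^sub>m 0 N) (0\<^sub>m 0 0)"
      using X by (intro eq_matI) auto
    then have "X * S = four_block_mat X (0\<^sub>m N 0) (0\<^sub>m 0 N) (0\<^sub>m 0 0) * S" by simp
    also have "\<dots> = four_block_mat (X * U1) (X * U2) (0\<^sub>m 0 k) (0\<^sub>m 0 l)"
      unfolding S_def using U X
      by (subst mult_four_block_mat[of _ N N _ 0 _ 0 _ _ k _ l]) auto
    also have "\<dots> = S * four_block_mat X1 (0\<^sub>m k l) (0\<^sub>m l k) X2"
      unfolding S_def using U X
      by (subst mult_four_block_mat[of _ N k _ l _ 0 _ _ k _ l])
        (auto simp: e)
    finally show ?thesis .
  qed
  have wf: "rmod_wf (AB_mod N \<delta> A B)" "rmod_wf (AB_mod k \<delta> A1 B1)" "rmod_wf (AB_mod l \<delta> A2 B2)"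
    using A A1 A2 by (auto intro: rmod_wf_AB_mod)
  show ?thesis
  proof (rule rmod_isoI[OF _ _ _ _ P S PS])
    fix g
    note i1 = AB_mod_intertwine[OF A A1 U(1) int(1,2), of \<delta> g]
    note i2 = AB_mod_intertwine[OF A A2 U(2) int(3,4), of \<delta> g]
    show "snd (AB_mod N \<delta> A B) g * S = S * snd (rmod_dsum (AB_mod k \<delta> A1 B1) (AB_mod l \<delta> A2 B2)) g"
      using int'[OF _ _ _ i1 i2] wf unfolding rmod_dsum_def rmod_wf_def
      by (simp add: AB_mod_def)
  qed (use wf N in \<open>auto simp: rmod_wf_dsum\<close>, auto simp: AB_mod_def rmod_dsum_def)
qed
section \<open>Irreducibility, reversal and centrosymmetry\<close>

text \<open>Polynomials in \<open>B\<close> are the projections onto its eigenlines, so an invariant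
  subspace contains every unit vector on which one of its members has a nonzero coordinate. The
  nonzero entries of \<open>T\<close> next to the diagonal then lead from one unit vector to all
  others.\<close>

lemma AB_mod_irreducible:
  assumes T: "T \<in> carrier_mat k k" and B: "B \<in> carrier_mat k k" and k: "k > 0"
    and diag: "\<And>i j. i < k \<Longrightarrow> j < k \<Longrightarrow> B $$ (i,j) = (if i = j then h i else 0)"
    and inj: "\<And>i j. i < j \<Longrightarrow> j < k \<Longrightarrow> h i \<noteq> h j"
    and off: "\<And>j. Suc j < k \<Longrightarrow> T $$ (j, Suc j) \<noteq> 0 \<and> T $$ (Suc j, j) \<noteq> 0"
  shows "rmod_irreducible (AB_mod k \<delta> T B)"
proof -
  have "W = {0\<^sub>v k} \<or> W = carrier_vec k" if W: "rmod_invariant (AB_mod k \<delta> T B) W" for W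
  proof (cases "W \<subseteq> {0\<^sub>v k}")
    case True
    then show ?thesis using W by (auto simp: rmod_invariant_def fst_AB_mod)
  next
    case False
    have sub: "W \<subseteq> carrier_vec k" and zero: "0\<^sub>v k \<in> W"
      and add: "\<And>v w. v \<in> W \<Longrightarrow> w \<in> W \<Longrightarrow> v + w \<in> W"
      and smult: "\<And>c v. v \<in> W \<Longrightarrow> c \<cdot>\<^sub>v v \<in> W"
      and WA: "\<And>v. v \<in> W \<Longrightarrow> T *\<^sub>v v \<in> W" and WB: "\<And>v. v \<in> W \<Longrightarrow> B *\<^sub>v v \<in> W"
    proof -
      have "snd (AB_mod k \<delta> T B) GA = T" "snd (AB_mod k \<delta> T B) GB = B" by (auto simp: AB_mod_def)
      then show "\<And>v. v \<in> W \<Longrightarrow> T *\<^sub>v v \<in> W" "\<And>v. v \<in> W \<Longrightarrow> B *\<^sub>v v \<in> W"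
        using W unfolding rmod_invariant_def by metis+
    qed (use W in \<open>auto simp: rmod_invariant_def fst_AB_mod\<close>)
    have Bv: "B *\<^sub>v v = vec k (\<lambda>i. h i * v $ i)" if v: "v \<in> carrier_vec k" for v
    proof (rule eq_vecI)
      fix i assume "i < dim_vec (vec k (\<lambda>i. h i * v $ i))"
      then have i: "i < k" by simp
      have "(B *\<^sub>v v) $ i = (\<Sum>j\<in>{0..<k}. (if i = j then h i else 0) * v $ j)"
        using i B v by (auto simp: scalar_prod_def diag intro!: sum.cong)
      also have "\<dots> = (\<Sum>j\<in>{0..<k}. if j = i then h i * v $ i else 0)"
        by (intro sum.cong) auto
      finally show "(B *\<^sub>v v) $ i = vec k (\<lambda>i. h i * v $ i) $ i" using i by simp
    qed (use B in auto)
    \<comment> \<open>The vector is the product of the operators \<open>B - h l\<close> for l in K,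
      applied to v. With K all indices but j only the coordinate j survives, since the
      \<open>h l\<close> are distinct.\<close>
    have proj: "vec k (\<lambda>i. (\<Prod>l\<in>K. h i - h l) * v $ i) \<in> W" if "v \<in> W" "finite K" for v K
      using that(2)
    proof (induction K rule: finite_induct)
      case empty
      have "vec k (\<lambda>i. v $ i) = v" using sub that by (intro eq_vecI) auto
      then show ?case using that by simp
    next
      case (insert l K)
      let ?u = "vec k (\<lambda>i. (\<Prod>l\<in>K. h i - h l) * v $ i)"
      have "B *\<^sub>v ?u + (- h l) \<cdot>\<^sub>v ?u \<in> W" using insert.IH by (intro add WB smult)
      moreover have "B *\<^sub>v ?u + (- h l) \<cdot>\<^sub>v ?u = vec k (\<lambda>i. (\<Prod>l\<in>insert l K. h i - h l) * v $ i)"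
        using insert.hyps by (subst Bv) (auto intro!: eq_vecI simp: algebra_simps)
      ultimately show ?case by simp
    qed
    have unit: "unit_vec k j \<in> W" if v: "v \<in> W" and j: "j < k" "v $ j \<noteq> 0" for v j
    proof -
      define p where "p = (\<Prod>l\<in>{..<k} - {j}. h j - h l)"
      have "h j \<noteq> h l" if "l < k" "l \<noteq> j" for l
        using inj[of j l] inj[of l j] that j by (metis nat_neq_iff)
      then have p: "p \<noteq> 0" unfolding p_def by simp
      have "inverse (p * v $ j) \<cdot>\<^sub>v vec k (\<lambda>i. (\<Prod>l\<in>{..<k} - {j}. h i - h l) * v $ i) \<in> W"
        using v by (intro smult proj) auto
      moreover have "inverse (p * v $ j) \<cdot>\<^sub>v vec k (\<lambda>i. (\<Prod>l\<in>{..<k} - {j}. h i - h l) * v $ i)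
        = unit_vec k j"
      proof (rule eq_vecI)
        fix i assume i: "i < dim_vec (unit_vec k j :: complex vec)"
        have "(\<Prod>l\<in>{..<k} - {j}. h i - h l) = 0" if "i \<noteq> j"
          using i that by (intro prod_zero) auto
        then show "(inverse (p * v $ j) \<cdot>\<^sub>v vec k (\<lambda>i. (\<Prod>l\<in>{..<k} - {j}. h i - h l) * v $ i)) $ i
          = unit_vec k j $ i"
          using i j p by (cases "i = j") (auto simp: p_def[symmetric] field_simps)
      qed auto
      ultimately show ?thesis by simp
    qed
    have step: "unit_vec k i \<in> W" if "unit_vec k j \<in> W" "i < k" "j < k" "T $$ (i,j) \<noteq> 0" for i j
    proof (rule unit[OF WA[OF that(1)] that(2)])
      show "(T *\<^sub>v unit_vec k j) $ i \<noteq> 0" using T that by simp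
    qed
    obtain v j where v: "v \<in> W" and j: "j < k" "v $ j \<noteq> 0"
    proof -
      obtain v where v: "v \<in> W" "v \<noteq> 0\<^sub>v k" using False by auto
      then have "\<exists>j<k. v $ j \<noteq> 0" using sub by (metis carrier_vecD eq_vecI index_zero_vec subsetD)
      then show ?thesis using v that by auto
    qed
    \<comment> \<open>Descent to the unit vector of index 0; truncated subtraction keeps the index
      there once it is reached. The ascent from 0 then covers all indices.\<close>
    have "unit_vec k (j - t) \<in> W" for t
    proof (induction t)
      case 0
      then show ?case using unit[OF v j] by simp
    next
      case (Suc t)
      show ?case
      proof (cases "j - t")
        case (Suc i)
        then have e: "j - Suc t = i" by simp
        show ?thesis unfolding e using Suc.IH off[of i] j Suc by (intro step[of "Suc i" i]) auto
      qed (use Suc in auto)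
    qed
    from this[of j] have unit0: "unit_vec k 0 \<in> W" by simp
    have all: "unit_vec k t \<in> W" if "t < k" for t
      using that
    proof (induction t)
      case (Suc t)
      then show ?case using off[of t] by (intro step[of t "Suc t"]) auto
    qed (use unit0 in auto)
    have "w \<in> W" if w: "w \<in> carrier_vec k" for w
    proof -
      have "vec k (\<lambda>i. if i < t then w $ i else 0) \<in> W" if "t \<le> k" for t
        using that
      proof (induction t)
        case 0
        have "vec k (\<lambda>i. 0) = (0\<^sub>v k :: complex vec)" by (intro eq_vecI) auto
        then show ?case using zero by simp
      next
        case (Suc t)
        have "vec k (\<lambda>i. if i < t then w $ i else 0) + (w $ t) \<cdot>\<^sub>v unit_vec k t \<in> W"
          using Suc all by (intro add smult) auto
        moreover have "vec k (\<lambda>i. if i < t then w $ i else 0) + (w $ t) \<cdot>\<^sub>v unit_vec k t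
            = vec k (\<lambda>i. if i < Suc t then w $ i else 0)"
          using Suc.prems by (intro eq_vecI) (auto simp: less_Suc_eq)
        ultimately show ?case by simp
      qed
      from this[of k] have "vec k (\<lambda>i. if i < k then w $ i else 0) \<in> W" by simp
      moreover have "vec k (\<lambda>i. if i < k then w $ i else 0) = w" using w by (intro eq_vecI) auto
      ultimately show ?thesis by simp
    qed
    then show ?thesis using sub by blast
  qed
  then show ?thesis using k by (auto simp: rmod_irreducible_def fst_AB_mod)
qed

section \<open>Reversing the basis\<close>

lemma sum_times_delta:
  fixes f :: "nat \<Rightarrow> complex"
  assumes "a < k"
  shows "(\<Sum>l\<in>{0..<k}. f l * (if l = a then 1 else 0)) = f a"
    and "(\<Sum>l\<in>{0..<k}. (if l = a then 1 else 0) * f l) = f a"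
  using assms by (simp_all add: if_distrib if_distribR cong: if_cong)

definition rev_mat :: "complex mat \<Rightarrow> complex mat" where
  "rev_mat A = mat (dim_row A) (dim_row A) (\<lambda>(i,j). A $$ (dim_row A - 1 - i, dim_row A - 1 - j))"

text \<open>Needed for odd n: in the order v_1, v_3, ... the eigenvalues of B are those of b = -3/4,
  and the reversed order gives b = -1/4.\<close>

lemma AB_mod_iso_rev:
  assumes A: "A \<in> carrier_mat k k" and B: "B \<in> carrier_mat k k"
  shows "rmod_iso (AB_mod k \<delta> A B) (AB_mod k \<delta> (rev_mat A) (rev_mat B))"
proof -
  define J :: "complex mat" where "J = mat k k (\<lambda>(i,j). if i = k - 1 - j then 1 else 0)"
  have J: "J \<in> carrier_mat k k" by (simp add: J_def)
  have right: "(X * J) $$ (i,j) = X $$ (i, k - 1 - j)" if "X \<in> carrier_mat k k" "i < k" "j < k" for X i j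
    using that by (simp add: J_def scalar_prod_def sum_times_delta)
  have left: "(J * X) $$ (i,j) = X $$ (k - 1 - i, j)" if "X \<in> carrier_mat k k" "i < k" "j < k" for X i j
  proof -
    have "i = k - Suc l \<longleftrightarrow> l = k - Suc i" if "l < k" for l using that \<open>i < k\<close> by auto
    then have "(J * X) $$ (i,j) = (\<Sum>l\<in>{0..<k}. (if l = k - Suc i then 1 else 0) * X $$ (l, j))"
      using that by (auto simp: J_def scalar_prod_def intro!: sum.cong)
    then show ?thesis using that by (simp add: sum_times_delta)
  qed
  have JJ: "J * J = 1\<^sub>m k"
  proof (rule eq_matI)
    fix i j assume "i < dim_row (1\<^sub>m k :: complex mat)" "j < dim_col (1\<^sub>m k :: complex mat)"
    then show "(J * J) $$ (i,j) = 1\<^sub>m k $$ (i,j)"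
      using left[OF J, of i j] by (auto simp: J_def)
  qed (use J in auto)
  have "X * J = J * rev_mat X" if X: "X \<in> carrier_mat k k" for X
  proof -
    have R: "rev_mat X \<in> carrier_mat k k" using X by (simp add: rev_mat_def)
    show ?thesis
    proof (rule eq_matI)
      fix i j assume "i < dim_row (J * rev_mat X)" "j < dim_col (J * rev_mat X)"
      then have ij: "i < k" "j < k" using J R by auto
      show "(X * J) $$ (i,j) = (J * rev_mat X) $$ (i,j)"
        unfolding right[OF X ij] left[OF R ij] using X ij by (simp add: rev_mat_def)
    qed (use J X R in auto)
  qed
  then show ?thesis
    using A B J JJ by (intro AB_mod_isoI[where S=J and P=J]) (auto simp: rev_mat_def)
qed

section \<open>Splitting along the eigenspaces of the flip\<close>

definition centrosymmetric :: "complex mat \<Rightarrow> bool" where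
  "centrosymmetric A \<longleftrightarrow> (\<forall>i<dim_row A. \<forall>j<dim_row A.
     A $$ (dim_row A - 1 - i, dim_row A - 1 - j) = A $$ (i,j))"

text \<open>A centrosymmetric matrix commutes with the flip of the basis. On the \<open>\<epsilon>\<close>-eigenspace of the
  flip it acts by the following matrix with respect to the basis \<open>e\<^sub>j + \<epsilon> e\<^bsub>N-1-j\<^esub>\<close>; the middle basis
  vector is \<open>2 e\<^sub>j\<close>, which accounts for the weight 1/2.\<close>
definition fold_mat :: "complex \<Rightarrow> nat \<Rightarrow> complex mat \<Rightarrow> complex mat" where
  "fold_mat \<epsilon> k A = mat k k (\<lambda>(i,j). (if 2*i+1 = dim_row A then 1/2 else 1) *
     (A $$ (i,j) + \<epsilon> * A $$ (i, dim_row A - 1 - j)))"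

text \<open>k is the dimension of the \<epsilon>-eigenspace of the flip in dimension N. The middle
  basis vector, present for odd N, is fixed by the flip and so counts for \<epsilon> = 1.\<close>

definition half_dim :: "complex \<Rightarrow> nat \<Rightarrow> nat \<Rightarrow> bool" where
  "half_dim \<epsilon> N k \<longleftrightarrow> \<epsilon> = 1 \<and> k = (N+1) div 2 \<or> \<epsilon> = -1 \<and> k = N div 2"

definition flip_basis :: "complex \<Rightarrow> nat \<Rightarrow> nat \<Rightarrow> complex mat" where
  "flip_basis \<epsilon> N k = mat N k (\<lambda>(i,j). (if i = j then 1 else 0) + (if i = N - 1 - j then \<epsilon> else 0))"

text \<open>The basis dual to \<open>flip_basis\<close>. The weights are the inverse squared lengths
  of the basis vectors: 2 in general, but 4 for the middle vector, which is twice a unit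
  vector.\<close>

definition flip_cobasis :: "complex \<Rightarrow> nat \<Rightarrow> nat \<Rightarrow> complex mat" where
  "flip_cobasis \<epsilon> N k = mat k N (\<lambda>(j,i). (if 2*j+1 = N then 1/4 else 1/2) *
     ((if i = j then 1 else 0) + (if i = N - 1 - j then \<epsilon> else 0)))"

lemma sum_flip:
  fixes f :: "nat \<Rightarrow> complex"
  assumes "j < N"
  shows "(\<Sum>i\<in>{0..<N}. f i * ((if i = j then 1 else 0) + (if i = N - 1 - j then \<epsilon> else 0)))
    = f j + f (N - 1 - j) * \<epsilon>"
proof -
  have "(\<Sum>i\<in>{0..<N}. f i * ((if i = j then 1 else 0) + (if i = N - 1 - j then \<epsilon> else 0))) =
    (\<Sum>i\<in>{0..<N}. (if i = j then f j else 0) + (if i = N - 1 - j then f (N - 1 - j) * \<epsilon> else 0))"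
    by (intro sum.cong) (auto simp: algebra_simps)
  then show ?thesis using assms by (simp add: sum.distrib)
qed

text \<open>For rows with 2r + 1 < N the claim is the definition of \<open>fold_mat\<close>; for 2r
  + 1 > N it is the mirror row multiplied by \<epsilon>, by centrosymmetry. In the middle row the
  weight 1/2 compensates for the doubled basis vector if \<epsilon> = 1, and both sides vanish if
  \<epsilon> = -1.\<close>

lemma fold_mat_intertwine:
  assumes A: "A \<in> carrier_mat N N" and cs: "centrosymmetric A" and k: "half_dim \<epsilon> N k"
  shows "A * flip_basis \<epsilon> N k = flip_basis \<epsilon> N k * fold_mat \<epsilon> k A"
proof (rule eq_matI)
  fix r j
  assume "r < dim_row (flip_basis \<epsilon> N k * fold_mat \<epsilon> k A)"
    and "j < dim_col (flip_basis \<epsilon> N k * fold_mat \<epsilon> k A)"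
  then have r: "r < N" and j: "j < k" by (auto simp: flip_basis_def fold_mat_def)
  have kN: "k \<le> N" and eps: "\<epsilon> * \<epsilon> = 1" using k by (auto simp: half_dim_def)
  define g where "g i = fold_mat \<epsilon> k A $$ (i,j)" for i
  have cs': "A $$ (N - Suc r, l) = A $$ (r, N - Suc l)" if "l < N" for l
  proof -
    have "A $$ (N - 1 - r, N - 1 - (N - 1 - l)) = A $$ (r, N - 1 - l)"
      using cs[unfolded centrosymmetric_def, rule_format, of r "N - 1 - l"] r that A by simp
    then show ?thesis using that by simp
  qed
  have "(A * flip_basis \<epsilon> N k) $$ (r,j) =
      (\<Sum>i\<in>{0..<N}. A $$ (r,i) * ((if i = j then 1 else 0) + (if i = N - 1 - j then \<epsilon> else 0)))"
    using A r j by (auto simp: flip_basis_def scalar_prod_def intro!: sum.cong)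
  also have "\<dots> = A $$ (r,j) + A $$ (r, N - 1 - j) * \<epsilon>" using j kN by (intro sum_flip) auto
  finally have L: "(A * flip_basis \<epsilon> N k) $$ (r,j) = A $$ (r,j) + A $$ (r, N - 1 - j) * \<epsilon>" .
  have "(flip_basis \<epsilon> N k * fold_mat \<epsilon> k A) $$ (r,j) =
      (\<Sum>i\<in>{0..<k}. (if i = r then g r else 0) + (if i = N - 1 - r then \<epsilon> * g (N - 1 - r) else 0))"
    using r j kN by (auto simp: flip_basis_def fold_mat_def g_def scalar_prod_def algebra_simps intro!: sum.cong)
  then have R: "(flip_basis \<epsilon> N k * fold_mat \<epsilon> k A) $$ (r,j) =
      (if r < k then g r else 0) + (if N - 1 - r < k then \<epsilon> * g (N - 1 - r) else 0)"
    by (simp add: sum.distrib)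
  have g: "g i = (if 2*i+1 = N then 1/2 else 1) * (A $$ (i,j) + \<epsilon> * A $$ (i, N - 1 - j))" if "i < k" for i
    using that j A by (auto simp: g_def fold_mat_def)
  consider (mid) "2 * r + 1 = N" | (low) "2 * r + 1 < N" | (high) "2 * r + 1 > N" by linarith
  then show "(A * flip_basis \<epsilon> N k) $$ (r,j) = (flip_basis \<epsilon> N k * fold_mat \<epsilon> k A) $$ (r,j)"
  proof cases
    case mid
    then have e: "N - Suc r = r" by simp
    show ?thesis
    proof (cases "\<epsilon> = 1")
      case True
      then have "r < k" using k mid by (auto simp: half_dim_def)
      then show ?thesis unfolding L R using True g[of r] mid e by (simp add: algebra_simps)
    next
      case False
      then have "\<epsilon> = -1" "k = N div 2" using k by (auto simp: half_dim_def)
      moreover then have "\<not> r < k" using mid by auto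
      ultimately show ?thesis unfolding L R using cs'[of j] e j kN by simp
    qed
  next
    case low
    then have "r < k" "\<not> N - 1 - r < k" using k by (auto simp: half_dim_def)
    then show ?thesis unfolding L R using g[of r] low by (simp add: algebra_simps)
  next
    case high
    then have *: "\<not> r < k" "N - 1 - r < k" "2 * (N - 1 - r) + 1 \<noteq> N" using k r by (auto simp: half_dim_def)
    then have "g (N - 1 - r) = A $$ (r, N - 1 - j) + \<epsilon> * A $$ (r, j)"
      using g[of "N - 1 - r"] cs'[of j] cs'[of "N - 1 - j"] j kN by simp
    then show ?thesis unfolding L R using * eps by (simp add: algebra_simps)
  qed
qed (use A in \<open>auto simp: flip_basis_def fold_mat_def\<close>)

text \<open>Both indices stay in the lower half, so a vector can meet the mirror image of another
  only at the middle. Elsewhere the entry for j = j' is (1 + \<epsilon> \<epsilon>')/2. Allowing two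
  signs covers duality and orthogonality of the eigenspaces at once.\<close>

lemma flip_cobasis_mult:
  assumes k: "half_dim \<epsilon> N k" and k': "half_dim \<epsilon>' N k'" and j: "j < k" "j' < k'"
  shows "(flip_cobasis \<epsilon> N k * flip_basis \<epsilon>' N k') $$ (j,j') = (if j = j' \<and> \<epsilon> = \<epsilon>' then 1 else 0)"
proof -
  have kN: "j < N" "j' < N" "k \<le> N" "k' \<le> N" using k k' j by (auto simp: half_dim_def)
  let ?w = "(if 2*j+1 = N then 1/4 else 1/2 :: complex)"
  have "(flip_cobasis \<epsilon> N k * flip_basis \<epsilon>' N k') $$ (j,j') =
    (\<Sum>i\<in>{0..<N}. (?w * flip_basis \<epsilon>' N k' $$ (i,j')) * ((if i = j then 1 else 0) + (if i = N - 1 - j then \<epsilon> else 0)))"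
    using j kN by (auto simp: flip_basis_def flip_cobasis_def scalar_prod_def intro!: sum.cong)
  also have "\<dots> = ?w * flip_basis \<epsilon>' N k' $$ (j,j') + ?w * flip_basis \<epsilon>' N k' $$ (N - 1 - j,j') * \<epsilon>"
    using kN by (intro sum_flip) auto
  also have "\<dots> = ?w * (((if j = j' then 1 else 0) + (if j = N - 1 - j' then \<epsilon>' else 0)) +
       ((if N - 1 - j = j' then 1 else 0) + (if N - 1 - j = N - 1 - j' then \<epsilon>' else 0)) * \<epsilon>)"
    using j kN by (simp add: flip_basis_def algebra_simps)
  also have "\<dots> = (if j = j' \<and> \<epsilon> = \<epsilon>' then 1 else 0)"
  proof -
    have e: "N - 1 - j = N - 1 - j' \<longleftrightarrow> j = j'" "j = N - 1 - j' \<longleftrightarrow> j + j' + 1 = N" "N - 1 - j = j' \<longleftrightarrow> j + j' + 1 = N"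
      using kN by auto
    have "j + j' + 1 = N \<Longrightarrow> \<epsilon> = \<epsilon>' \<Longrightarrow> j = j'" "\<epsilon> = -1 \<Longrightarrow> 2 * j + 1 \<noteq> N"
      using k k' j by (auto simp: half_dim_def)
    moreover have "j = j' \<Longrightarrow> j + j' + 1 = N \<longleftrightarrow> 2 * j + 1 = N" by auto
    ultimately show ?thesis unfolding e using k k' by (auto simp: half_dim_def)
  qed
  finally show ?thesis .
qed

lemma centrosymmetric_iso_dsum:
  assumes A: "A \<in> carrier_mat N N" "B \<in> carrier_mat N N"
    and cs: "centrosymmetric A" "centrosymmetric B"
    and h: "half_dim \<epsilon> N k" "half_dim (-\<epsilon>) N l"
  shows "rmod_iso (AB_mod N \<delta> A B)
    (rmod_dsum (AB_mod k \<delta> (fold_mat \<epsilon> k A) (fold_mat \<epsilon> k B))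
      (AB_mod l \<delta> (fold_mat (-\<epsilon>) l A) (fold_mat (-\<epsilon>) l B)))"
proof -
  have N: "N = k + l" using h by (auto simp: half_dim_def)
  have "- \<epsilon> \<noteq> \<epsilon>" using h by (auto simp: half_dim_def)
  then show ?thesis
    by (intro AB_mod_iso_dsumI[where ?U1.0="flip_basis \<epsilon> N k" and ?U2.0="flip_basis (-\<epsilon>) N l"
      and ?V1.0="flip_cobasis \<epsilon> N k" and ?V2.0="flip_cobasis (-\<epsilon>) N l"]
      A N fold_mat_intertwine cs h eq_matI)
    (auto simp: flip_cobasis_mult[OF h(1) h(1)] flip_cobasis_mult[OF h(2) h(2)]
        flip_cobasis_mult[OF h(1) h(2)] flip_cobasis_mult[OF h(2) h(1)]
       simp del: index_mult_mat(1), auto simp: fold_mat_def flip_basis_def flip_cobasis_def)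
qed
section \<open>Tridiagonal models of \<open>R\<^sub>d(a,b,c)\<close>\<close>

text \<open>As polynomials in \<open>t\<close>, both sides are quartics with the same two leading coefficients, and they
  agree at \<open>t = -1, 0, u - 1\<close>.\<close>
lemma quartic_interpolation:
  fixes u t p g0 g1 g2 :: complex
  assumes u: "u \<noteq> 0" "u - 1 \<noteq> 0" "u + 1 \<noteq> 0"
    and G: "\<And>s. G s = s^4 - (2*p + 2 + u) * s^3 + g2 * s^2 + g1 * s + g0"
  shows "G 0 * (u - t) * (u - t - 1) / ((u + 1) * u)
      + (p^2 - (p - t)^2 + G 1 / (u - 1) - G 0 / (u + 1)) * (t + 1) * (u - 1 - t)
      + G u * t * (t + 1) / ((u - 1) * u) = G (t + 1)"
proof -
  have "G 0 * (u - t) * (u - t - 1) * (u - 1)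
      + ((p^2 - (p - t)^2) * (u - 1) * (u + 1) + G 1 * (u + 1) - G 0 * (u - 1)) * (t + 1) * (u - 1 - t) * u
      + G u * t * (t + 1) * (u + 1) = G (t + 1) * (u * (u - 1) * (u + 1))"
  proof -
    have G01: "G 0 = g0" "G 1 = g0 + g1 + g2 - 1 - 2 * p - u" by (simp_all add: G)
    show ?thesis unfolding G01 unfolding G
      by (simp add: algebra_simps power2_eq_square power3_eq_cube power4_eq_xxxx)
  qed
  moreover have "(u * (u - 1) * (u + 1)) * (G 0 * (u - t) * (u - t - 1) / ((u + 1) * u)
      + (p^2 - (p - t)^2 + G 1 / (u - 1) - G 0 / (u + 1)) * (t + 1) * (u - 1 - t)
      + G u * t * (t + 1) / ((u - 1) * u)) =
      G 0 * (u - t) * (u - t - 1) * (u - 1)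
      + ((p^2 - (p - t)^2) * (u - 1) * (u + 1) + G 1 * (u + 1) - G 0 * (u - 1)) * (t + 1) * (u - 1 - t) * u
      + G u * t * (t + 1) * (u + 1)"
  proof -
    have "(u * (u - 1) * (u + 1)) * (x / ((u + 1) * u) + (y + z / (u - 1) - w / (u + 1)) * v + q / ((u - 1) * u)) =
      x * (u - 1) + (y * (u - 1) * (u + 1) + z * (u + 1) - w * (u - 1)) * (v * u) + q * (u + 1)" for x y z w v q
    proof -
      \<comment> \<open>Naming the fractions and rewriting the numerators through them turns the
        clearing of denominators into a polynomial identity.\<close>
      define X Z W Q where "X = x / ((u + 1) * u)" and "Z = z / (u - 1)" and "W = w / (u + 1)"
        and "Q = q / ((u - 1) * u)"
      then have e: "x = X * ((u + 1) * u)" "z = Z * (u - 1)" "w = W * (u + 1)" "q = Q * ((u - 1) * u)"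
        using u by auto
      show ?thesis unfolding X_def[symmetric] Z_def[symmetric] W_def[symmetric] Q_def[symmetric]
        unfolding e by (simp add: algebra_simps)
    qed
    from this[of _ _ _ _ "(t + 1) * (u - 1 - t)"] show ?thesis by (simp add: mult.assoc)
  qed
  ultimately have "(u * (u - 1) * (u + 1)) * (G 0 * (u - t) * (u - t - 1) / ((u + 1) * u)
      + (p^2 - (p - t)^2 + G 1 / (u - 1) - G 0 / (u + 1)) * (t + 1) * (u - 1 - t)
      + G u * t * (t + 1) / ((u - 1) * u)) = (u * (u - 1) * (u + 1)) * G (t + 1)"
    by (simp add: mult.commute)
  then show ?thesis using u by (simp only: mult_cancel_left) auto
qed

text \<open>\<phi> as a polynomial in its index: it has to be evaluated at the reflected node m - j,
  which is not a natural number when n is odd.\<close>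

definition Rphi_at :: "nat \<Rightarrow> complex \<Rightarrow> complex \<Rightarrow> complex \<Rightarrow> complex \<Rightarrow> complex" where
  "Rphi_at d a b c z = z * (z - of_nat d - 1) * (a + b + c + of_nat d / 2 - z + 2)
      * (a + b - c + of_nat d / 2 - z + 1)"

lemma Rphi_eq_Rphi_at: "Rphi d a b c i = Rphi_at d a b c (of_nat i)"
  by (simp add: Rphi_def Rphi_at_def)

text \<open>The interpolation identity with origin at the node z. There u = m - 2z is the distance
  from z to its reflection m - z = z + u, so the three data are \<phi> at z, at z + 1 and at the
  reflection.\<close>

lemma Rphi_at_interpolation:
  fixes a b c z t :: complex and d :: nat
  defines "u \<equiv> 2 * b + of_nat d + 1 - 2 * z"
  assumes u: "u \<noteq> 0" "u - 1 \<noteq> 0" "u + 1 \<noteq> 0"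
  shows "Rphi_at d a b c z * (u - t) * (u - t - 1) / ((u + 1) * u)
      + ((a + of_nat d / 2 - z) * (a + of_nat d / 2 - z + 1)
         - (a + of_nat d / 2 - (z + t)) * (a + of_nat d / 2 - (z + t) + 1)
         + Rphi_at d a b c (z + 1) / (u - 1) - Rphi_at d a b c z / (u + 1)) * (t + 1) * (u - 1 - t)
      + Rphi_at d a b c (z + u) * t * (t + 1) / ((u - 1) * u) = Rphi_at d a b c (z + t + 1)"
proof -
  \<comment> \<open>Completing the square: the diagonal entry of A at the node z is p^2 - 1/4, so
    that differences of such entries are differences of squares.\<close>
  define p where "p = a + of_nat d / 2 - z + 1/2"
  define D where "D = (of_nat d + 1 :: complex)"
  define F where "F = a + b + c + of_nat d / 2 - z + 2"
  define F' where "F' = a + b - c + of_nat d / 2 - z + 1"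
  have G: "Rphi_at d a b c (z + s) = s^4 - (2*p + 2 + u) * s^3
      + (F * F' - (2*z - D) * (F + F') + z * (z - D)) * s^2
      + ((2*z - D) * F * F' - z * (z - D) * (F + F')) * s + z * (z - D) * F * F'" for s
  proof -
    have "Rphi_at d a b c (z + s) = (z + s) * (z + s - D) * (F - s) * (F' - s)"
      by (simp add: Rphi_at_def F_def F'_def D_def algebra_simps)
    \<comment> \<open>This matches the cubic coefficient of \<phi> with the one that the
      interpolation requires; c cancels in F + F'.\<close>
    moreover have "2*p + 2 + u = F + F' - (2*z - D)"
      by (simp add: p_def u_def F_def F'_def D_def field_simps)
    ultimately show ?thesis
      by (simp only:) (simp add: algebra_simps power2_eq_square power3_eq_cube power4_eq_xxxx)
  qed
  have th: "(a + of_nat d / 2 - z) * (a + of_nat d / 2 - z + 1)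
         - (a + of_nat d / 2 - (z + t)) * (a + of_nat d / 2 - (z + t) + 1) = p^2 - (p - t)^2"
    by (simp add: p_def power2_eq_square field_simps)
  show ?thesis unfolding th
    using quartic_interpolation[OF u, of "\<lambda>s. Rphi_at d a b c (z + s)" p, OF G, of t]
    by (simp add: add.assoc)
qed

lemma sum_tridiagonal:
  fixes x f :: "nat \<Rightarrow> complex"
  assumes j: "j < N" and tri: "\<And>l. l < N \<Longrightarrow> Suc j < l \<or> Suc l < j \<Longrightarrow> x l = 0"
  shows "(\<Sum>l\<in>{0..<N}. x l * f l) = (if j > 0 then x (j - 1) * f (j - 1) else 0) + x j * f j
    + (if Suc j < N then x (Suc j) * f (Suc j) else 0)"
proof -
  have "(\<Sum>l\<in>{0..<N}. x l * f l) = (\<Sum>l\<in>{0..<N}. (if l = j - 1 then (if j > 0 then x (j - 1) * f (j - 1) else 0) else 0)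
    + (if l = j then x j * f j else 0) + (if l = Suc j then x (Suc j) * f (Suc j) else 0))"
  proof (rule sum.cong)
    fix l assume "l \<in> {0..<N}"
    then have "x l = 0" if "Suc j < l \<or> Suc l < j" using tri that by simp
    moreover have "(Suc j < l \<or> Suc l < j) \<or> (l = j - 1 \<and> j > 0) \<or> l = j \<or> l = Suc j" by linarith
    ultimately show "x l * f l = (if l = j - 1 then (if j > 0 then x (j - 1) * f (j - 1) else 0) else 0)
      + (if l = j then x j * f j else 0) + (if l = Suc j then x (Suc j) * f (Suc j) else 0)"
      by (cases "Suc j < l \<or> Suc l < j") auto
  qed simp
  then show ?thesis using j by (simp add: sum.distrib)
qed

lemma upper_triangular_left_inverse:
  fixes Q :: "complex mat"
  assumes Q: "Q \<in> carrier_mat k k" and ut: "upper_triangular Q" and nz: "\<And>i. i < k \<Longrightarrow> Q $$ (i,i) \<noteq> 0"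
  obtains P where "P \<in> carrier_mat k k" "P * Q = 1\<^sub>m k"
proof -
  have "det Q \<noteq> 0"
    unfolding det_upper_triangular[OF ut Q] using nz Q by (auto simp: prod_list_zero_iff diag_mat_def)
  from det_non_zero_imp_unit[OF Q this, of undefined] show ?thesis
    using that by (auto simp: Units_def ring_mat_def)
qed

text \<open>The entries of \<open>A\<close> on \<open>R\<^sub>d(a,b,c)\<close> with respect to an eigenbasis of \<open>B\<close>. The formula for the off-diagonal
  products has the form 0/0 at \<open>j = d - 1\<close> when \<open>m = 2d\<close>, and so it is stated through \<open>r\<close>, with a separate
  condition for this case. For \<open>j = d\<close> and \<open>m = 2d + 1\<close>, the division by zero in the diagonal entry
  has numerator \<open>\<phi>\<^bsub>d+1\<^esub> = 0\<close>.\<close>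
locale racah_tridiagonal =
  fixes d :: nat and a b c m :: complex and T :: "complex mat" and r :: "nat \<Rightarrow> complex"
  assumes m: "m = 2 * b + of_nat d + 1"
    and T: "T \<in> carrier_mat (d+1) (d+1)"
    and tri: "\<And>i j. i \<le> d \<Longrightarrow> j \<le> d \<Longrightarrow> Suc i < j \<or> Suc j < i \<Longrightarrow> T $$ (i,j) = 0"
    and diagT: "\<And>j. j \<le> d \<Longrightarrow> T $$ (j,j) = Rtheta d a j
      + Rphi d a b c (Suc j) / (m - 2 * of_nat j - 1) - Rphi d a b c j / (m - 2 * of_nat j + 1)"
    and off: "\<And>j. j < d \<Longrightarrow> T $$ (j, Suc j) * T $$ (Suc j, j) * (m - 2 * of_nat j - 1) = r j * Rphi d a b c (Suc j)"
    and r: "\<And>j. j < d \<Longrightarrow> r j * (m - 2 * of_nat j - 2) * (m - 2 * of_nat j - 1) * (m - 2 * of_nat j)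
      = Rphi_at d a b c (m - of_nat j)"
    and nz: "\<And>j. j < d \<Longrightarrow> T $$ (j, Suc j) \<noteq> 0" "\<And>j. j < d \<Longrightarrow> T $$ (Suc j, j) \<noteq> 0"
    and m_ne: "\<And>s. s < 2 * d \<Longrightarrow> m \<noteq> of_nat s" "m \<noteq> -1"
    and last: "\<And>e. d = Suc e \<Longrightarrow> m = 2 * of_nat d \<Longrightarrow> Rphi d a b c e / 12 + T $$ (e,e) + r e = Rtheta d a d"
begin

abbreviation "\<theta> \<equiv> Rtheta d a"
abbreviation "\<theta>s \<equiv> Rtheta d b"
abbreviation "\<phi> \<equiv> Rphi d a b c"

text \<open>The recursion in \<open>i\<close> is forced by the bidiagonal action of \<open>B\<close>, because
  \<open>\<theta>*\<^sub>j - \<theta>*\<^sub>k = (k - j)(m - j - k)\<close>; the diagonal is forced by the subdiagonal entries 1 of \<open>A\<close>.\<close>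
definition coef :: "nat \<Rightarrow> nat \<Rightarrow> complex" where
  "coef i j = (\<Prod>k<j. T $$ (Suc k, k)) *
     (\<Prod>k\<in>{j<..i}. \<phi> k / ((of_nat k - of_nat j) * (m - of_nat j - of_nat k)))"

section \<open>Entries of the transition matrix\<close>

lemma phi_0: "\<phi> 0 = 0" and phi_last: "\<phi> (Suc d) = 0"
  by (simp_all add: Rphi_def)

lemma theta_diff: "\<theta>s j - \<theta>s k = (of_nat k - of_nat j) * (m - of_nat j - of_nat k)"
  by (simp add: Rtheta_def m field_simps)

text \<open>Two distinct indices up to d, or an index below d taken twice, have a sum below 2d. The
  bound leaves m = 2d admissible.\<close>

lemma node_ne: "i + j < 2 * d \<Longrightarrow> m - of_nat i - of_nat j \<noteq> 0"
  using m_ne(1)[of "i + j"] by (auto simp: algebra_simps)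

lemma coef_diag: "coef j j = (\<Prod>k<j. T $$ (Suc k, k))"
  by (simp add: coef_def)

lemma coef_diag_Suc: "coef (Suc j) (Suc j) = T $$ (Suc j, j) * coef j j"
  by (simp add: coef_diag)

lemma coef_Suc:
  assumes "j \<le> i"
  shows "coef (Suc i) j = coef i j * \<phi> (Suc i) / ((of_nat (Suc i) - of_nat j) * (m - of_nat j - of_nat (Suc i)))"
proof -
  have "{j<..Suc i} = insert (Suc i) {j<..i}" using assms by auto
  then show ?thesis by (simp add: coef_def)
qed

lemma coef_Suc_mult:
  assumes "j \<le> i" "Suc i \<le> d"
  shows "coef (Suc i) j * ((of_nat i - of_nat j + 1) * (m - of_nat j - of_nat i - 1)) = coef i j * \<phi> (Suc i)"
proof -
  have e: "(of_nat (Suc i) - of_nat j) * (m - of_nat j - of_nat (Suc i)) =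
    (of_nat i - of_nat j + 1) * (m - of_nat j - of_nat i - 1)"
    by (simp add: algebra_simps)
  have "of_nat (Suc i) - of_nat j \<noteq> (0::complex)"
    using assms of_nat_eq_iff[of "Suc i" j, where ?'a=complex] by (simp del: of_nat_eq_iff of_nat_Suc)
  moreover have "m - of_nat j - of_nat (Suc i) \<noteq> 0" using node_ne[of j "Suc i"] assms by simp
  ultimately show ?thesis using coef_Suc[OF assms(1)] unfolding e[symmetric] by simp
qed

lemma coef_Suc_diag:
  assumes "j < d"
  shows "coef (Suc j) j * (m - 2 * of_nat j - 1) = coef j j * \<phi> (Suc j)"
  using coef_Suc_mult[of j j] assms by simp

text \<open>Kept apart from \<open>coef_right\<close>, whose factor m - 2j - 2 turns that statement
  into 0 = 0 for m = 2d, i = d and j = d - 1. This version survives and is what the degenerate case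
  uses.\<close>

lemma coef_right_diag:
  assumes "j < d"
  shows "T $$ (j, Suc j) * coef (Suc j) (Suc j) = coef (Suc j) j * r j"
proof -
  let ?v = "m - 2 * of_nat j - 1"
  have n: "?v \<noteq> 0" using node_ne[of j "Suc j"] assms by (simp add: algebra_simps)
  have "T $$ (j, Suc j) * coef (Suc j) (Suc j) * ?v = coef j j * (T $$ (j, Suc j) * T $$ (Suc j, j) * ?v)"
    unfolding coef_diag_Suc by (simp only: ac_simps)
  also have "\<dots> = r j * (coef j j * \<phi> (Suc j))" unfolding off[OF assms] by (simp only: ac_simps)
  also have "\<dots> = coef (Suc j) j * r j * ?v" unfolding coef_Suc_diag[OF assms, symmetric] by (simp only: ac_simps)
  finally show ?thesis using n by simp
qed

lemma coef_left_diag: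
  assumes "j < d"
  shows "T $$ (Suc j, j) * coef (Suc j) j * (m - 2 * of_nat j - 1) = coef (Suc j) (Suc j) * \<phi> (Suc j)"
  unfolding coef_diag_Suc mult.assoc coef_Suc_diag[OF assms] by (simp add: mult.assoc)

text \<open>Induction step for the ratio of neighbouring entries in one column of the transition
  matrix. Passing to the next column multiplies both by the same value \<open>f\<close> of \<phi>
  and divides them by different linear factors, so \<open>f\<close> drops out of the ratio.
  \<open>K\<close> and \<open>K'\<close> hold the part that depends on the row only.\<close>

lemma cross_step:
  fixes v :: complex
  assumes "x1 * (\<tau> * w) = x0 * f" "y1 * (\<sigma> * v) = y0 * f" "x0 * v * K = y0 * \<tau> * K'" "\<tau> \<noteq> 0" "v \<noteq> 0"
  shows "x1 * w * K = y1 * \<sigma> * K'"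
proof -
  have "(x1 * w * K) * (\<tau> * v) = (x1 * (\<tau> * w)) * (v * K)" by (simp only: ac_simps)
  also have "\<dots> = (x0 * v * K) * f" unfolding assms(1) by (simp only: ac_simps)
  also have "\<dots> = (y0 * f) * (\<tau> * K')" unfolding assms(3) by (simp only: ac_simps)
  also have "\<dots> = (y1 * \<sigma> * K') * (\<tau> * v)" unfolding assms(2)[symmetric] by (simp only: ac_simps)
  finally show ?thesis using assms(4,5) by simp
qed

lemma coef_cross_step:
  assumes "Suc j \<le> i" "Suc i \<le> d"
    and "coef i (Suc j) * (m - of_nat j - of_nat i - 1) * K = coef i j * (of_nat i - of_nat j) * K'"
  shows "coef (Suc i) (Suc j) * (m - of_nat j - of_nat (Suc i) - 1) * K = coef (Suc i) j * (of_nat (Suc i) - of_nat j) * K'"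
proof -
  have e: "of_nat i - of_nat (Suc j) + 1 = (of_nat i - of_nat j :: complex)"
    "m - of_nat (Suc j) - of_nat i - 1 = m - of_nat j - of_nat (Suc i) - 1"
    "of_nat i - of_nat j + 1 = (of_nat (Suc i) - of_nat j :: complex)" by simp_all
  show ?thesis
  proof (rule cross_step[OF _ _ assms(3)])
    show "coef (Suc i) (Suc j) * ((of_nat i - of_nat j) * (m - of_nat j - of_nat (Suc i) - 1)) = coef i (Suc j) * \<phi> (Suc i)"
      using coef_Suc_mult[of "Suc j" i] assms unfolding e by simp
    show "coef (Suc i) j * ((of_nat (Suc i) - of_nat j) * (m - of_nat j - of_nat i - 1)) = coef i j * \<phi> (Suc i)"
      using coef_Suc_mult[of j i] assms unfolding e by simp
    show "of_nat i - of_nat j \<noteq> (0::complex)" using assms by simp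
    show "m - of_nat j - of_nat i - 1 \<noteq> 0" using node_ne[of j "Suc i"] assms by (simp add: algebra_simps)
  qed
qed

text \<open>Together with \<open>coef_left\<close> this expresses the entries above and below
  \<open>coef i j\<close> in its column through \<open>coef i j\<close> itself, which can then be
  factored out of the equation for A.\<close>

lemma coef_right:
  assumes "Suc j \<le> i" "i \<le> d"
  shows "coef i (Suc j) * (m - of_nat j - of_nat i - 1) * T $$ (j, Suc j)
    = coef i j * (of_nat i - of_nat j) * (r j * (m - 2 * of_nat j - 2))"
  using assms
proof (induction i rule: dec_induct)
  case base
  have e: "m - of_nat j - of_nat (Suc j) - 1 = m - 2 * of_nat j - 2" by simp
  have "coef (Suc j) (Suc j) * (m - 2 * of_nat j - 2) * T $$ (j, Suc j)
    = (T $$ (j, Suc j) * coef (Suc j) (Suc j)) * (m - 2 * of_nat j - 2)" by (simp only: ac_simps)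
  then show ?case using coef_right_diag[of j] base unfolding e by simp
next
  case (step i)
  then show ?case by (intro coef_cross_step) auto
qed

lemma coef_left:
  assumes "Suc j \<le> i" "i \<le> d"
  shows "coef i (Suc j) * (m - of_nat j - of_nat i - 1) * \<phi> (Suc j) =
    coef i j * (of_nat i - of_nat j) * (T $$ (Suc j, j) * (m - 2 * of_nat j - 1) * (m - 2 * of_nat j - 2))"
  using assms
proof (induction i rule: dec_induct)
  case base
  have e: "m - of_nat j - of_nat (Suc j) - 1 = m - 2 * of_nat j - 2" by simp
  have "coef (Suc j) (Suc j) * (m - 2 * of_nat j - 2) * \<phi> (Suc j)
    = (coef (Suc j) (Suc j) * \<phi> (Suc j)) * (m - 2 * of_nat j - 2)" by (simp only: ac_simps)
  then show ?case using coef_left_diag[of j] base unfolding e by (simp add: ac_simps)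
next
  case (step i)
  then show ?case by (intro coef_cross_step) auto
qed

text \<open>The entry (j,i) of T Q = Q A. With \<open>coef i j\<close> factored out it is the
  interpolation identity for z = j and t = i - j, divided by (t + 1)(u - 1 - t); the left neighbour
  contributes \<phi> at j, the right neighbour \<phi> at m - j, and the next column \<phi> at i +
  1.\<close>

lemma coef_row:
  assumes j: "j \<le> i" and i: "i \<le> d"
  shows "(if j > 0 then T $$ (j, j - 1) * coef i (j - 1) else 0) + T $$ (j,j) * coef i j
      + (if j < i then T $$ (j, Suc j) * coef i (Suc j) else 0)
    = coef i j * \<theta> i + (if i < d then coef (Suc i) j else 0)"
proof (cases "i = j")
  case True
  \<comment> \<open>The neighbours of a diagonal entry produce the two fractions of
    \<open>diagT\<close>. A neighbour missing at j = 0 or j = d is matched by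
    \<open>\<phi> 0\<close> or \<open>\<phi> (Suc d)\<close>, which vanish.\<close>
  have "(if j > 0 then T $$ (j, j - 1) * coef j (j - 1) else 0) = coef j j * \<phi> j / (m - 2 * of_nat j + 1)"
  proof (cases j)
    case (Suc l)
    then have n: "m - 2 * of_nat j + 1 \<noteq> 0"
      using node_ne[of l "Suc l"] True i by (auto simp: algebra_simps)
    then show ?thesis using coef_left_diag[of l] Suc True i
      by (simp add: field_simps)
  qed (simp add: phi_0)
  moreover have "(if j < d then coef (Suc j) j else 0) = coef j j * \<phi> (Suc j) / (m - 2 * of_nat j - 1)"
    using True i phi_last by (auto simp: coef_Suc algebra_simps not_less)
  moreover have jd: "j \<le> d" using True i by simp
  ultimately show ?thesis unfolding True diagT[OF jd] by (simp add: algebra_simps)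
next
  case False
  then have ji: "j < i" using j by simp
  define z where "z = (of_nat j :: complex)"
  define t where "t = (of_nat i - of_nat j :: complex)"
  define u where "u = m - 2 * z"
  define C where "C = coef i j"
  have zi: "of_nat i = z + t" by (simp add: z_def t_def)
  have t1: "t + 1 \<noteq> 0" and t0: "t \<noteq> 0"
    using ji of_nat_eq_iff[of i j, where ?'a=complex] of_nat_eq_iff[of "Suc i" j, where ?'a=complex]
    by (auto simp: t_def algebra_simps simp del: of_nat_eq_iff)
  have u0: "u \<noteq> 0" "u - 1 \<noteq> 0"
    using node_ne[of j j] node_ne[of j "Suc j"] ji i by (auto simp: u_def z_def algebra_simps)
  \<comment> \<open>u + 1 is the factor m - (j - 1) - j; at j = 0 it is m + 1, whence the assumption
    that m is not -1.\<close>
  have u1: "u + 1 \<noteq> 0"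
  proof (cases j)
    case 0
    then show ?thesis using m_ne(2) by (auto simp: u_def z_def add_eq_0_iff2)
  next
    case (Suc l)
    then show ?thesis using node_ne[of l j] ji i by (auto simp: u_def z_def algebra_simps)
  qed
  have left: "(if j > 0 then T $$ (j, j - 1) * coef i (j - 1) else 0) = C * (\<phi> j * (u - t) / ((t + 1) * (u + 1) * u))"
  proof (cases j)
    case (Suc l)
    have "T $$ (j, l) * coef i l * (t + 1) * (u + 1) * u = C * \<phi> j * (u - t)"
    proof -
      have e: "m - of_nat l - of_nat i - 1 = u - t" "of_nat i - of_nat l = t + 1" "m - 2 * of_nat l - 1 = u + 1"
        "m - 2 * of_nat l - 2 = u" using Suc by (simp_all add: u_def z_def t_def)
      show ?thesis using coef_left[of l i, unfolded e] Suc ji i by (simp add: C_def ac_simps)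
    qed
    then show ?thesis using u0 u1 t1 Suc by (simp add: eq_divide_eq mult.assoc)
  qed (simp add: phi_0)
  have tail: "(if i < d then coef (Suc i) j else 0) = C * (\<phi> (Suc i) / ((t + 1) * (u - 1 - t)))"
    using ji i phi_last by (auto simp: coef_Suc C_def t_def u_def z_def algebra_simps not_less)
  show ?thesis
  proof (cases "u - 1 - t = 0")
    \<comment> \<open>u - 1 - t = m - i - j - 1 vanishes only for i = d = j + 1 and m = 2d. Then t =
      1 and u = 2, so (t + 1)(u + 1)u/(u - t) = 12, the constant in \<open>last\<close>.\<close>
    case True
    then have "m = of_nat (i + j + 1)" by (simp add: u_def z_def t_def algebra_simps)
    then have "\<not> i + j + 1 < 2 * d" using m_ne(1)[of "i + j + 1"] by blast
    then have ij: "i = d" "d = Suc j" using ji i by auto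
    then have "t = 1" by (simp add: t_def)
    with True have "u = 2" by simp
    have "m = 2 * of_nat d" using \<open>m = of_nat (i + j + 1)\<close> ij by (simp add: algebra_simps)
    then have l: "\<phi> j / 12 + T $$ (j,j) + r j = \<theta> d" using last[of j] ij by simp
    have right: "T $$ (j, Suc j) * coef i (Suc j) = C * r j" using coef_right_diag[of j] ij by (simp add: C_def)
    have "C * (\<phi> j / 12) + T $$ (j,j) * C + C * r j = C * \<theta> d"
      unfolding l[symmetric] by (simp add: algebra_simps)
    then show ?thesis
      unfolding left right tail C_def[symmetric] using ij(1) ji \<open>t = 1\<close> \<open>u = 2\<close> by simp
  next
    case ne: False
    have "T $$ (j, Suc j) * coef i (Suc j) * (u - 1 - t) = C * (r j * (u - 2)) * t"
    proof -
      have e: "m - of_nat j - of_nat i - 1 = u - 1 - t" "of_nat i - of_nat j = t" "m - 2 * of_nat j - 2 = u - 2"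
        by (simp_all add: u_def z_def t_def)
      show ?thesis using coef_right[of j i, unfolded e] ji i by (simp add: C_def ac_simps)
    qed
    moreover have "r j * (u - 2) = Rphi_at d a b c (z + u) / ((u - 1) * u)"
    proof -
      have e: "m - 2 * of_nat j = u" "m - of_nat j = z + u" by (simp_all add: u_def z_def)
      show ?thesis using r[of j, unfolded e] u0 ji i by (simp add: eq_divide_eq mult.assoc)
    qed
    ultimately have "T $$ (j, Suc j) * coef i (Suc j) * (u - 1 - t) = C * (Rphi_at d a b c (z + u) / ((u - 1) * u)) * t"
      by simp
    then have "T $$ (j, Suc j) * coef i (Suc j) = C * (Rphi_at d a b c (z + u) / ((u - 1) * u)) * t / (u - 1 - t)"
      by (simp only: nonzero_eq_divide_eq[OF ne])
    then have right: "T $$ (j, Suc j) * coef i (Suc j) = C * (Rphi_at d a b c (z + u) * t / ((u - 1) * u * (u - 1 - t)))"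
      by (simp add: ac_simps)
    have u_eq: "2 * b + of_nat d + 1 - 2 * z = u" by (simp add: u_def m)
    have d1: "T $$ (j,j) = \<theta> j + Rphi_at d a b c (z + 1) / (u - 1) - \<phi> j / (u + 1)"
      using diagT[of j] ji i by (simp add: u_def z_def Rphi_eq_Rphi_at add.commute)
    have "\<phi> j * (u - t) * (u - t - 1) / ((u + 1) * u) + (T $$ (j,j) - \<theta> i) * (t + 1) * (u - 1 - t)
       + Rphi_at d a b c (z + u) * t * (t + 1) / ((u - 1) * u) = \<phi> (Suc i)"
      using Rphi_at_interpolation[of b d z a c t, unfolded u_eq, OF u0 u1]
      unfolding d1 Rphi_eq_Rphi_at Rtheta_def zi[symmetric] z_def[symmetric]
      by (simp add: zi algebra_simps)
    then have "(\<phi> j * (u - t) * (u - t - 1) / ((u + 1) * u) + (T $$ (j,j) - \<theta> i) * (t + 1) * (u - 1 - t)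
       + Rphi_at d a b c (z + u) * t * (t + 1) / ((u - 1) * u)) / ((t + 1) * (u - 1 - t)) = \<phi> (Suc i) / ((t + 1) * (u - 1 - t))"
      by simp
    also have "(\<phi> j * (u - t) * (u - t - 1) / ((u + 1) * u) + (T $$ (j,j) - \<theta> i) * (t + 1) * (u - 1 - t)
       + Rphi_at d a b c (z + u) * t * (t + 1) / ((u - 1) * u)) / ((t + 1) * (u - 1 - t)) =
       \<phi> j * (u - t) / ((t + 1) * (u + 1) * u) + (T $$ (j,j) - \<theta> i) + Rphi_at d a b c (z + u) * t / ((u - 1) * u * (u - 1 - t))"
    proof -
      have e: "u - t - 1 = u - 1 - t" by simp
      show ?thesis unfolding e using ne t1 u0 u1 by (simp add: add_divide_distrib) (simp only: ac_simps)
    qed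
    finally have key: "\<phi> j * (u - t) / ((t + 1) * (u + 1) * u) + (T $$ (j,j) - \<theta> i)
       + Rphi_at d a b c (z + u) * t / ((u - 1) * u * (u - 1 - t)) = \<phi> (Suc i) / ((t + 1) * (u - 1 - t))" .
    show ?thesis unfolding left tail right key[symmetric] C_def[symmetric] using ji
      by (simp add: algebra_simps)
  qed
qed

section \<open>Isomorphism with the bidiagonal form, and irreducibility\<close>

lemma iso: "rmod_iso (AB_mod (d+1) (Rdelta d a b c) T (mat (d+1) (d+1) (\<lambda>(i,j). if i = j then \<theta>s i else 0)))
    (Rmod d a b c)"
proof -
  define Q where "Q = mat (d+1) (d+1) (\<lambda>(j,i). if j \<le> i then coef i j else 0)"
  define B where "B = mat (d+1) (d+1) (\<lambda>(i,j). if i = j then \<theta>s i else 0)"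
  have Q: "Q \<in> carrier_mat (d+1) (d+1)" and B: "B \<in> carrier_mat (d+1) (d+1)" by (simp_all add: Q_def B_def)
  have RA: "RmatA d a \<in> carrier_mat (d+1) (d+1)" and RB: "RmatB d a b c \<in> carrier_mat (d+1) (d+1)"
    by (simp_all add: RmatA_def RmatB_def)
  obtain P where P: "P \<in> carrier_mat (d+1) (d+1)" "P * Q = 1\<^sub>m (d+1)"
  proof (rule upper_triangular_left_inverse[OF Q])
    show "upper_triangular Q" by (auto simp: upper_triangular_def Q_def)
    show "Q $$ (i,i) \<noteq> 0" if "i < d + 1" for i
      using that nz(2) by (auto simp: Q_def coef_diag)
  qed
  have TQ: "T * Q = Q * RmatA d a"
  proof (rule eq_matI)
    fix j i assume "j < dim_row (Q * RmatA d a)" "i < dim_col (Q * RmatA d a)"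
    then have ji: "j \<le> d" "i \<le> d" using Q RA by auto
    have "(T * Q) $$ (j,i) = (\<Sum>l\<in>{0..<d+1}. T $$ (j,l) * Q $$ (l,i))"
      using T Q ji by (auto simp: scalar_prod_def intro!: sum.cong)
    also have "\<dots> = (if j > 0 then T $$ (j, j - 1) * Q $$ (j - 1, i) else 0) + T $$ (j,j) * Q $$ (j,i)
      + (if Suc j < d + 1 then T $$ (j, Suc j) * Q $$ (Suc j, i) else 0)"
      using ji tri by (intro sum_tridiagonal) auto
    finally have L: "(T * Q) $$ (j,i) = (if j > 0 then T $$ (j, j - 1) * Q $$ (j - 1, i) else 0) + T $$ (j,j) * Q $$ (j,i)
      + (if Suc j < d + 1 then T $$ (j, Suc j) * Q $$ (Suc j, i) else 0)" .
    have "(Q * RmatA d a) $$ (j,i) = (\<Sum>l\<in>{0..<d+1}. RmatA d a $$ (l,i) * Q $$ (j,l))"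
      using Q RA ji by (auto simp: scalar_prod_def mult.commute intro!: sum.cong)
    also have "\<dots> = (if i > 0 then RmatA d a $$ (i - 1, i) * Q $$ (j, i - 1) else 0) + RmatA d a $$ (i,i) * Q $$ (j,i)
      + (if Suc i < d + 1 then RmatA d a $$ (Suc i, i) * Q $$ (j, Suc i) else 0)"
      using ji by (intro sum_tridiagonal) (auto simp: RmatA_def)
    also have "\<dots> = Q $$ (j,i) * \<theta> i + (if i < d then Q $$ (j, Suc i) else 0)"
      using ji by (auto simp: RmatA_def)
    finally have R: "(Q * RmatA d a) $$ (j,i) = Q $$ (j,i) * \<theta> i + (if i < d then Q $$ (j, Suc i) else 0)" .
    consider "j \<le> i" | "j = Suc i" | "Suc i < j" by linarith
    then show "(T * Q) $$ (j,i) = (Q * RmatA d a) $$ (j,i)"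
    proof cases
      case 1
      have "(if j > 0 then T $$ (j, j - 1) * Q $$ (j - 1, i) else 0) = (if j > 0 then T $$ (j, j - 1) * coef i (j - 1) else 0)"
        "Q $$ (j,i) = coef i j"
        "(if Suc j < d + 1 then T $$ (j, Suc j) * Q $$ (Suc j, i) else 0) = (if j < i then T $$ (j, Suc j) * coef i (Suc j) else 0)"
        "(if i < d then Q $$ (j, Suc i) else 0) = (if i < d then coef (Suc i) j else 0)"
        using 1 ji by (auto simp: Q_def)
      then show ?thesis unfolding L R using coef_row[OF 1 ji(2)] by simp
    next
      case 2
      then show ?thesis unfolding L R using ji by (auto simp: Q_def coef_diag_Suc)
    next
      case 3
      then show ?thesis unfolding L R using ji by (auto simp: Q_def)
    qed
  qed (use T Q RA in auto)
  have BQ: "B * Q = Q * RmatB d a b c"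
  proof (rule eq_matI)
    fix j i assume "j < dim_row (Q * RmatB d a b c)" "i < dim_col (Q * RmatB d a b c)"
    then have ji: "j \<le> d" "i \<le> d" using Q RB by auto
    have "(B * Q) $$ (j,i) = (\<Sum>l\<in>{0..<d+1}. B $$ (j,l) * Q $$ (l,i))"
      using B Q ji by (auto simp: scalar_prod_def intro!: sum.cong)
    also have "\<dots> = (if j > 0 then B $$ (j, j - 1) * Q $$ (j - 1, i) else 0) + B $$ (j,j) * Q $$ (j,i)
      + (if Suc j < d + 1 then B $$ (j, Suc j) * Q $$ (Suc j, i) else 0)"
      using ji by (intro sum_tridiagonal) (auto simp: B_def)
    also have "\<dots> = \<theta>s j * Q $$ (j,i)" using ji by (auto simp: B_def)
    finally have L: "(B * Q) $$ (j,i) = \<theta>s j * Q $$ (j,i)" .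
    have "(Q * RmatB d a b c) $$ (j,i) = (\<Sum>l\<in>{0..<d+1}. RmatB d a b c $$ (l,i) * Q $$ (j,l))"
      using Q RB ji by (auto simp: scalar_prod_def mult.commute intro!: sum.cong)
    also have "\<dots> = (if i > 0 then RmatB d a b c $$ (i - 1, i) * Q $$ (j, i - 1) else 0) + RmatB d a b c $$ (i,i) * Q $$ (j,i)
      + (if Suc i < d + 1 then RmatB d a b c $$ (Suc i, i) * Q $$ (j, Suc i) else 0)"
      using ji by (intro sum_tridiagonal) (auto simp: RmatB_def)
    also have "\<dots> = (if i > 0 then \<phi> i * Q $$ (j, i - 1) else 0) + \<theta>s i * Q $$ (j,i)"
      using ji by (auto simp: RmatB_def)
    finally have R: "(Q * RmatB d a b c) $$ (j,i) = (if i > 0 then \<phi> i * Q $$ (j, i - 1) else 0) + \<theta>s i * Q $$ (j,i)" .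
    consider "j = i" | "i < j" | "j < i" by linarith
    then show "(B * Q) $$ (j,i) = (Q * RmatB d a b c) $$ (j,i)"
    proof cases
      case 1
      then show ?thesis unfolding L R using ji by (auto simp: Q_def)
    next
      case 2
      then show ?thesis unfolding L R using ji by (auto simp: Q_def)
    next
      case 3
      then obtain l where l: "i = Suc l" "j \<le> l" by (cases i) auto
      have "of_nat i - of_nat j \<noteq> (0::complex)" using 3 of_nat_eq_iff[of i j, where ?'a=complex] by simp
      moreover have "m - of_nat j - of_nat i \<noteq> 0" using node_ne[of j i] 3 ji by simp
      ultimately have "coef i j * (\<theta>s j - \<theta>s i) = \<phi> i * coef l j"
        unfolding theta_diff l(1) using coef_Suc[OF l(2)] by simp
      then show ?thesis unfolding L R using 3 ji l by (simp add: Q_def algebra_simps)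
    qed
  qed (use B Q RB in auto)
  show ?thesis unfolding Rmod_eq_AB_mod B_def[symmetric]
    by (rule AB_mod_isoI[OF T B RA RB Q P TQ BQ])
qed

text \<open>Irreducibility is visible in the eigenbasis of B and is transported to the bidiagonal
  form.\<close>

lemma irreducible: "rmod_irreducible (Rmod d a b c)"
proof (rule rmod_irreducible_iso[OF iso])
  show "rmod_irreducible (AB_mod (d+1) (Rdelta d a b c) T (mat (d+1) (d+1) (\<lambda>(i,j). if i = j then \<theta>s i else 0)))"
  proof (rule AB_mod_irreducible[OF T, where h=\<theta>s])
    show "\<theta>s i \<noteq> \<theta>s j" if "i < j" "j < d + 1" for i j
    proof -
      have "of_nat j - of_nat i \<noteq> (0::complex)" using that of_nat_eq_iff[of i j, where ?'a=complex] by simp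
      moreover have "m - of_nat i - of_nat j \<noteq> 0" using node_ne[of i j] that by simp
      ultimately show ?thesis using theta_diff[of i j] by auto
    qed
  qed (use nz in auto)
qed (use T in \<open>auto simp: Rmod_eq_AB_mod RmatA_def RmatB_def intro!: rmod_wf_AB_mod\<close>)

end
section \<open>The action on the odd part of \<open>L\<^sub>n\<close>\<close>

definition LA :: "nat \<Rightarrow> nat \<Rightarrow> nat \<Rightarrow> complex" where
  "LA n r c = (if c = Suc r then (of_nat n - 2 * of_nat r - 1) * (of_nat n - 2 * of_nat r - 2)
     else if c = r then (of_nat n - 2 * of_nat r - 1) * (2 * of_nat r + 2)
       + (2 * of_nat r + 1) * (of_nat n - 2 * of_nat r) - 4
     else if r = Suc c then (2 * of_nat r + 1) * (2 * of_nat r) else 0) / 16"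

definition LB :: "nat \<Rightarrow> nat \<Rightarrow> complex" where
  "LB n r = ((of_nat n - 4 * of_nat r - 2)^2 - 4) / 16"

definition LA_mat :: "nat \<Rightarrow> complex mat" where
  "LA_mat n = mat ((n+1) div 2) ((n+1) div 2) (\<lambda>(r,c). LA n r c)"

definition LB_mat :: "nat \<Rightarrow> complex mat" where
  "LB_mat n = mat ((n+1) div 2) ((n+1) div 2) (\<lambda>(r,c). if r = c then LB n r else 0)"

definition sl2_comb :: "nat \<Rightarrow> complex \<Rightarrow> complex \<Rightarrow> complex mat" where
  "sl2_comb n \<alpha> \<beta> = mat (n+1) (n+1) (\<lambda>(i,k). if k = Suc i then \<alpha> * (of_nat n - of_nat i)
     else if i = Suc k then \<beta> * of_nat i else 0)"

lemma sl2_comb_eq: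
  "sl2E n = sl2_comb n 1 0" "sl2F n = sl2_comb n 0 1"
  "sl2E n + sl2F n = sl2_comb n 1 1" "\<i> \<cdot>\<^sub>m sl2E n - \<i> \<cdot>\<^sub>m sl2F n = sl2_comb n \<i> (-\<i>)"
  by (auto intro!: eq_matI simp: sl2E_def sl2F_def sl2_comb_def of_nat_diff)

lemma sl2_comb_mult_row:
  assumes Y: "Y \<in> carrier_mat (n+1) (n+1)" and i: "i \<le> n" and j: "j \<le> n"
  shows "((sl2_comb n \<alpha> \<beta> + x \<cdot>\<^sub>m 1\<^sub>m (n+1)) * Y) $$ (i,j) =
    (if i > 0 then \<beta> * of_nat i * Y $$ (i - 1, j) else 0) + x * Y $$ (i,j)
    + (if i < n then \<alpha> * (of_nat n - of_nat i) * Y $$ (Suc i, j) else 0)"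
proof -
  let ?X = "sl2_comb n \<alpha> \<beta> + x \<cdot>\<^sub>m 1\<^sub>m (n+1)"
  have X: "?X \<in> carrier_mat (n+1) (n+1)" by (simp add: sl2_comb_def)
  have "(?X * Y) $$ (i,j) = (\<Sum>k\<in>{0..<n+1}. ?X $$ (i,k) * Y $$ (k,j))"
    using X Y i j by (auto simp: scalar_prod_def intro!: sum.cong)
  also have "\<dots> = (if i > 0 then ?X $$ (i, i - 1) * Y $$ (i - 1, j) else 0) + ?X $$ (i,i) * Y $$ (i,j)
    + (if Suc i < n + 1 then ?X $$ (i, Suc i) * Y $$ (Suc i, j) else 0)"
    using i by (intro sum_tridiagonal) (auto simp: sl2_comb_def)
  also have "\<dots> = (if i > 0 then \<beta> * of_nat i * Y $$ (i - 1, j) else 0) + x * Y $$ (i,j)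
    + (if i < n then \<alpha> * (of_nat n - of_nat i) * Y $$ (Suc i, j) else 0)"
    using i by (auto simp: sl2_comb_def)
  finally show ?thesis .
qed

lemma sl2_comb_square:
  fixes \<alpha> \<beta> :: complex and n :: nat
  defines "X \<equiv> sl2_comb n \<alpha> \<beta>"
  assumes r: "r < (n+1) div 2" and c: "c < (n+1) div 2"
  shows "((X - 2 \<cdot>\<^sub>m 1\<^sub>m (n+1)) * (X + 2 \<cdot>\<^sub>m 1\<^sub>m (n+1))) $$ (2*r+1, 2*c+1) =
    (if c = Suc r then \<alpha>^2 * (of_nat n - 2 * of_nat r - 1) * (of_nat n - 2 * of_nat r - 2)
     else if c = r then \<alpha> * \<beta> * ((of_nat n - 2 * of_nat r - 1) * (2 * of_nat r + 2)
       + (2 * of_nat r + 1) * (of_nat n - 2 * of_nat r)) - 4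
     else if r = Suc c then \<beta>^2 * (2 * of_nat r + 1) * (2 * of_nat r) else 0)"
proof -
  have e: "X - 2 \<cdot>\<^sub>m 1\<^sub>m (n+1) = X + (-2) \<cdot>\<^sub>m 1\<^sub>m (n+1)"
    by (intro eq_matI) (auto simp: X_def sl2_comb_def)
  have rn: "2 * r + 1 \<le> n" "2 * c + 1 \<le> n" using r c by auto
  have Y: "X + 2 \<cdot>\<^sub>m 1\<^sub>m (n+1) \<in> carrier_mat (n+1) (n+1)" by (simp add: X_def sl2_comb_def)
  have ent: "(X + 2 \<cdot>\<^sub>m 1\<^sub>m (n+1)) $$ (i, k) = (if k = Suc i then \<alpha> * (of_nat n - of_nat i)
     else if i = Suc k then \<beta> * of_nat i else if i = k then 2 else 0)" if "i \<le> n" "k \<le> n" for i k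
    using that by (auto simp: X_def sl2_comb_def)
  have p: "2 * c + 1 = Suc (2 * r) \<longleftrightarrow> c = r" "2 * r = Suc (2 * c + 1) \<longleftrightarrow> r = Suc c"
     "2 * c + 1 = Suc (2 * r + 1) \<longleftrightarrow> False" "2 * r + 1 = Suc (2 * c + 1) \<longleftrightarrow> False" "2 * r + 1 = 2 * c + 1 \<longleftrightarrow> r = c"
     "2 * r = 2 * c + 1 \<longleftrightarrow> False" "2 * r + 2 = 2 * c + 1 \<longleftrightarrow> False"
     "2 * c + 1 = Suc (2 * r + 2) \<longleftrightarrow> c = Suc r" "2 * r + 2 = Suc (2 * c + 1) \<longleftrightarrow> r = c" by presburger+
  have "((X - 2 \<cdot>\<^sub>m 1\<^sub>m (n+1)) * (X + 2 \<cdot>\<^sub>m 1\<^sub>m (n+1))) $$ (2*r+1, 2*c+1) =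
    \<beta> * of_nat (2*r+1) * (X + 2 \<cdot>\<^sub>m 1\<^sub>m (n+1)) $$ (2*r, 2*c+1) + (-2) * (X + 2 \<cdot>\<^sub>m 1\<^sub>m (n+1)) $$ (2*r+1,2*c+1)
    + (if 2*r+1 < n then \<alpha> * (of_nat n - of_nat (2*r+1)) * (X + 2 \<cdot>\<^sub>m 1\<^sub>m (n+1)) $$ (2*r+2, 2*c+1) else 0)"
    unfolding e using sl2_comb_mult_row[OF Y rn, of \<alpha> \<beta> "-2"] by (simp add: X_def)
  also have "\<dots> = \<beta> * of_nat (2*r+1) * (if c = r then \<alpha> * (of_nat n - of_nat (2*r))
     else if r = Suc c then \<beta> * of_nat (2*r) else 0) + (-2) * (if r = c then 2 else 0)
    + \<alpha> * (of_nat n - of_nat (2*r+1)) * (if c = Suc r then \<alpha> * (of_nat n - of_nat (2*r+2))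
     else if r = c then \<beta> * of_nat (2*r+2) else 0)"
  proof -
    have i0: "2 * r \<le> n" using rn by simp
    have 1: "(X + 2 \<cdot>\<^sub>m 1\<^sub>m (n+1)) $$ (2*r, 2*c+1) = (if c = r then \<alpha> * (of_nat n - of_nat (2*r))
       else if r = Suc c then \<beta> * of_nat (2*r) else 0)"
      unfolding ent[OF i0 rn(2)] p by simp
    have 2: "(X + 2 \<cdot>\<^sub>m 1\<^sub>m (n+1)) $$ (2*r+1, 2*c+1) = (if r = c then 2 else 0)"
      unfolding ent[OF rn] p by simp
    \<comment> \<open>For 2r + 1 = n there is no row 2r + 2, but its coefficient n - (2r + 1) is
      zero, so the formula holds without a case distinction.\<close>
    have 3: "(if 2*r+1 < n then \<alpha> * (of_nat n - of_nat (2*r+1)) * (X + 2 \<cdot>\<^sub>m 1\<^sub>m (n+1)) $$ (2*r+2, 2*c+1) else 0)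
      = \<alpha> * (of_nat n - of_nat (2*r+1)) * (if c = Suc r then \<alpha> * (of_nat n - of_nat (2*r+2))
       else if r = c then \<beta> * of_nat (2*r+2) else 0)"
    proof (cases "2*r+1 < n")
      case True
      then have i2: "2*r+2 \<le> n" by simp
      have "(X + 2 \<cdot>\<^sub>m 1\<^sub>m (n+1)) $$ (2*r+2, 2*c+1) = (if c = Suc r then \<alpha> * (of_nat n - of_nat (2*r+2))
       else if r = c then \<beta> * of_nat (2*r+2) else 0)"
        unfolding ent[OF i2 rn(2)] p by simp
      then show ?thesis using True by simp
    next
      case False
      then have "n = 2*r+1" using rn by simp
      then show ?thesis by simp
    qed
    show ?thesis unfolding 1 2 3 ..
  qed
  also have "\<dots> = (if c = Suc r then \<alpha>^2 * (of_nat n - 2 * of_nat r - 1) * (of_nat n - 2 * of_nat r - 2)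
     else if c = r then \<alpha> * \<beta> * ((of_nat n - 2 * of_nat r - 1) * (2 * of_nat r + 2)
       + (2 * of_nat r + 1) * (of_nat n - 2 * of_nat r)) - 4
     else if r = Suc c then \<beta>^2 * (2 * of_nat r + 1) * (2 * of_nat r) else 0)"
    by (auto simp: power2_eq_square algebra_simps)
  finally show ?thesis .
qed

lemma sl2_square_entries:
  assumes i: "i \<le> n" and j: "j \<le> n"
  shows "(sl2E n * sl2E n) $$ (i,j) = (if j = i + 2 then (of_nat n - of_nat i) * (of_nat n - of_nat i - 1) else 0)"
    and "(sl2F n * sl2F n) $$ (i,j) = (if i = j + 2 then of_nat i * (of_nat i - 1) else 0)"
proof -
  have z: "sl2_comb n \<alpha> \<beta> = sl2_comb n \<alpha> \<beta> + 0 \<cdot>\<^sub>m 1\<^sub>m (n+1)" for \<alpha> \<beta>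
    by (intro eq_matI) (auto simp: sl2_comb_def)
  have c: "sl2_comb n \<alpha> \<beta> \<in> carrier_mat (n+1) (n+1)" for \<alpha> \<beta> by (simp add: sl2_comb_def)
  have "(sl2E n * sl2E n) $$ (i,j) = (if i < n then (of_nat n - of_nat i) * sl2_comb n 1 0 $$ (Suc i, j) else 0)"
    unfolding sl2_comb_eq by (subst (1) z, subst sl2_comb_mult_row[OF c i j]) simp
  then show "(sl2E n * sl2E n) $$ (i,j) = (if j = i + 2 then (of_nat n - of_nat i) * (of_nat n - of_nat i - 1) else 0)"
    using i j by (auto simp: sl2_comb_def algebra_simps)
  have "(sl2F n * sl2F n) $$ (i,j) = (if i > 0 then of_nat i * sl2_comb n 0 1 $$ (i - 1, j) else 0)"
    unfolding sl2_comb_eq by (subst (1) z, subst sl2_comb_mult_row[OF c i j]) simp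
  then show "(sl2F n * sl2F n) $$ (i,j) = (if i = j + 2 then of_nat i * (of_nat i - 1) else 0)"
    using i j by (auto simp: sl2_comb_def of_nat_diff)
qed

lemma diag_mult_row:
  fixes Y :: "complex mat"
  assumes "Y \<in> carrier_mat k k" "X \<in> carrier_mat k k" "i < k" "j < k"
    and "\<And>l. l < k \<Longrightarrow> X $$ (i,l) = (if i = l then x else 0)"
  shows "(X * Y) $$ (i,j) = x * Y $$ (i,j)"
proof -
  have "(X * Y) $$ (i,j) = (\<Sum>l\<in>{0..<k}. if l = i then x * Y $$ (i,j) else 0)"
    using assms by (auto simp: scalar_prod_def intro!: sum.cong simp del: sum.delta)
  then show ?thesis using assms by simp
qed

lemma diag_mult_col:
  fixes Y :: "complex mat"
  assumes "Y \<in> carrier_mat k k" "X \<in> carrier_mat k k" "i < k" "j < k"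
    and "\<And>l. l < k \<Longrightarrow> X $$ (l,j) = (if l = j then x else 0)"
  shows "(Y * X) $$ (i,j) = Y $$ (i,j) * x"
proof -
  have "(Y * X) $$ (i,j) = (\<Sum>l\<in>{0..<k}. if l = j then Y $$ (i,j) * x else 0)"
    using assms by (auto simp: scalar_prod_def intro!: sum.cong simp del: sum.delta)
  then show ?thesis using assms by simp
qed

lemma sl2H_shift_mult:
  assumes Y: "Y \<in> carrier_mat (n+1) (n+1)" and i: "i \<le> n" and j: "j \<le> n"
  shows "((sl2H n + x \<cdot>\<^sub>m 1\<^sub>m (n+1)) * Y) $$ (i,j) = (of_nat n - 2 * of_nat i + x) * Y $$ (i,j)"
  using i j by (intro diag_mult_row[OF Y]) (auto simp: sl2H_def)

text \<open>A + B + C equals (H^2 + 2EF + 2FE - 12)/16, and the Casimir element H^2 + 2EF + 2FE acts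
  on L_n as n(n + 2). This is the origin of the scalar; the proof compares entries.\<close>

lemma Lodd_eq_AB_mod:
  "Lodd n = AB_mod ((n+1) div 2) ((of_nat n * (of_nat n + 2) - 12) / 16) (LA_mat n) (LB_mat n)"
proof -
  define N where "N = (n+1) div 2"
  let ?\<delta> = "(of_nat n * (of_nat n + 2) - 12) / 16 :: complex"
  have car: "LA_mat n \<in> carrier_mat N N" "LB_mat n \<in> carrier_mat N N"
    by (auto simp: LA_mat_def LB_mat_def N_def)
  have minus: "sl2H n - 2 \<cdot>\<^sub>m 1\<^sub>m (n+1) = sl2H n + (-2) \<cdot>\<^sub>m 1\<^sub>m (n+1)"
    by (intro eq_matI) (auto simp: sl2H_def)
  have carH: "sl2H n + 2 \<cdot>\<^sub>m 1\<^sub>m (n+1) \<in> carrier_mat (n+1) (n+1)" by (simp add: sl2H_def)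
  have carE: "sl2E n * sl2E n \<in> carrier_mat (n+1) (n+1)" "sl2F n * sl2F n \<in> carrier_mat (n+1) (n+1)"
    by (auto simp: sl2E_def sl2F_def)
  have dims: "2 * r + 1 < n + 1" if "r < N" for r using that by (auto simp: N_def)
  have A: "sharpA n $$ (2*r+1, 2*c+1) = LA n r c" if "r < N" "c < N" for r c
  proof -
    have "sharpA n $$ (2*r+1, 2*c+1) = (1/16) * ((sl2_comb n 1 1 - 2 \<cdot>\<^sub>m 1\<^sub>m (n+1)) * (sl2_comb n 1 1 + 2 \<cdot>\<^sub>m 1\<^sub>m (n+1))) $$ (2*r+1, 2*c+1)"
      unfolding sharpA_def Let_def sl2_comb_eq(3) using dims[OF that(1)] dims[OF that(2)]
      by (simp del: index_mult_mat(1))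
    then show ?thesis using sl2_comb_square[of r n c 1 1] that by (simp add: N_def LA_def)
  qed
  have B: "sharpB n $$ (2*r+1, 2*c+1) = (if r = c then LB n r else 0)" if "r < N" "c < N" for r c
  proof -
    have "sharpB n $$ (2*r+1, 2*c+1) = (1/16) * ((sl2H n + (-2) \<cdot>\<^sub>m 1\<^sub>m (n+1)) * (sl2H n + 2 \<cdot>\<^sub>m 1\<^sub>m (n+1))) $$ (2*r+1, 2*c+1)"
      unfolding sharpB_def Let_def minus using dims[OF that(1)] dims[OF that(2)]
      by (simp del: index_mult_mat(1))
    also have "\<dots> = (1/16) * ((of_nat n - 2 * of_nat (2*r+1) + -2) * (sl2H n + 2 \<cdot>\<^sub>m 1\<^sub>m (n+1)) $$ (2*r+1,2*c+1))"
      using dims[OF that(1)] dims[OF that(2)] by (subst sl2H_shift_mult[OF carH]) auto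
    also have "\<dots> = (if r = c then LB n r else 0)"
      using dims that by (auto simp: sl2H_def LB_def power2_eq_square field_simps)
    finally show ?thesis .
  qed
  have C: "sharpC n $$ (2*r+1, 2*c+1) = (?\<delta> \<cdot>\<^sub>m 1\<^sub>m N - LA_mat n - LB_mat n) $$ (r,c)" if "r < N" "c < N" for r c
  proof -
    have "sharpC n $$ (2*r+1, 2*c+1) = (1/16) * ((sl2_comb n \<i> (-\<i>) - 2 \<cdot>\<^sub>m 1\<^sub>m (n+1)) * (sl2_comb n \<i> (-\<i>) + 2 \<cdot>\<^sub>m 1\<^sub>m (n+1))) $$ (2*r+1, 2*c+1)"
      unfolding sharpC_def Let_def sl2_comb_eq(4) using dims[OF that(1)] dims[OF that(2)]
      by (simp del: index_mult_mat(1))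
    also have "\<dots> = (1/16) * (if c = Suc r then - ((of_nat n - 2 * of_nat r - 1) * (of_nat n - 2 * of_nat r - 2))
     else if c = r then (of_nat n - 2 * of_nat r - 1) * (2 * of_nat r + 2)
       + (2 * of_nat r + 1) * (of_nat n - 2 * of_nat r) - 4
     else if r = Suc c then - ((2 * of_nat r + 1) * (2 * of_nat r)) else 0)"
      using that by (subst sl2_comb_square) (auto simp: N_def algebra_simps)
    also have "\<dots> = (?\<delta> \<cdot>\<^sub>m 1\<^sub>m N - LA_mat n - LB_mat n) $$ (r,c)"
      using that by (auto simp: N_def LA_mat_def LB_mat_def LA_def LB_def power2_eq_square field_simps)
    finally show ?thesis .
  qed
  \<comment> \<open>\<Delta> is given by its own formula in E, F and H, so 2\<Delta> = [A,B] has to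
    be verified. Since \<open>LB_mat\<close> is diagonal, the commutator only rescales the entries
    of \<open>LA_mat\<close> by differences of eigenvalues.\<close>
  have D: "sharpD n $$ (2*r+1, 2*c+1) = ((1/2) \<cdot>\<^sub>m (LA_mat n * LB_mat n - LB_mat n * LA_mat n)) $$ (r,c)"
    if rc: "r < N" "c < N" for r c
  proof -
    have i: "2*r+1 \<le> n" "2*c+1 \<le> n" using dims rc by fastforce+
    have "sharpD n $$ (2*r+1, 2*c+1) = (1/64) * (((sl2H n + 2 \<cdot>\<^sub>m 1\<^sub>m (n+1)) * (sl2F n * sl2F n)) $$ (2*r+1, 2*c+1)
      - ((sl2H n + (-2) \<cdot>\<^sub>m 1\<^sub>m (n+1)) * (sl2E n * sl2E n)) $$ (2*r+1, 2*c+1))"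
    proof -
      have "dim_col (sl2E n) = n + 1" "dim_col (sl2F n) = n + 1" by (simp_all add: sl2E_def sl2F_def)
      then show ?thesis
        unfolding sharpD_def Let_def minus using i by (simp del: index_mult_mat(1))
    qed
    also have "\<dots> = (1/64) * ((of_nat n - 2 * of_nat (2*r+1) + 2) * (if r = Suc c then of_nat (2*r+1) * of_nat (2*r) else 0)
      - (of_nat n - 2 * of_nat (2*r+1) + -2) * (if c = Suc r then (of_nat n - of_nat (2*r+1)) * (of_nat n - of_nat (2*r+1) - 1) else 0))"
    proof -
      have p: "2*r+1 = 2*c+1+2 \<longleftrightarrow> r = Suc c" "2*c+1 = 2*r+1+2 \<longleftrightarrow> c = Suc r" by auto
      have q: "of_nat (2*r+1) - 1 = (of_nat (2*r) :: complex)" by simp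
      show ?thesis
        unfolding sl2H_shift_mult[OF carE(1) i] sl2H_shift_mult[OF carE(2) i] sl2_square_entries[OF i] p q ..
    qed
    also have "\<dots> = (1/2) * (LA n r c * LB n c - LB n r * LA n r c)"
      by (auto simp: LA_def LB_def power2_eq_square field_simps)
    also have "\<dots> = (1/2) * ((LA_mat n * LB_mat n) $$ (r,c) - (LB_mat n * LA_mat n) $$ (r,c))"
    proof -
      have "(LA_mat n * LB_mat n) $$ (r,c) = LA_mat n $$ (r,c) * LB n c"
        using rc by (intro diag_mult_col[OF car]) (auto simp: LB_mat_def N_def)
      moreover have "(LB_mat n * LA_mat n) $$ (r,c) = LB n r * LA_mat n $$ (r,c)"
        using rc by (intro diag_mult_row[OF car]) (auto simp: LB_mat_def N_def)
      ultimately show ?thesis using rc by (simp add: LA_mat_def N_def)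
    qed
    finally show ?thesis using rc car by (simp del: index_mult_mat(1))
  qed
  have "mat N N (\<lambda>(r,c). sharp_gen n g $$ (2*r+1, 2*c+1)) =
    snd (AB_mod N ?\<delta> (LA_mat n) (LB_mat n)) g" for g
  proof (cases g)
    case GA
    then show ?thesis using A car by (intro eq_matI) (auto simp: AB_mod_def sharp_gen_def LA_mat_def N_def[symmetric])
  next
    case GB
    then show ?thesis using B car by (intro eq_matI) (auto simp: AB_mod_def sharp_gen_def LB_mat_def N_def[symmetric])
  next
    case GC
    show ?thesis
    proof (rule eq_matI)
      fix r c assume "r < dim_row (snd (AB_mod N ?\<delta> (LA_mat n) (LB_mat n)) g)" "c < dim_col (snd (AB_mod N ?\<delta> (LA_mat n) (LB_mat n)) g)"
      then have "r < N" "c < N" using GC car by (auto simp: AB_mod_def)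
      then show "mat N N (\<lambda>(r,c). sharp_gen n g $$ (2*r+1, 2*c+1)) $$ (r,c) = snd (AB_mod N ?\<delta> (LA_mat n) (LB_mat n)) g $$ (r,c)"
        unfolding GC AB_mod_def sharp_gen_def using C[of r c] by simp
    qed (use GC car in \<open>auto simp: AB_mod_def\<close>)
  next
    case GD
    show ?thesis
    proof (rule eq_matI)
      fix r c assume "r < dim_row (snd (AB_mod N ?\<delta> (LA_mat n) (LB_mat n)) g)" "c < dim_col (snd (AB_mod N ?\<delta> (LA_mat n) (LB_mat n)) g)"
      then have "r < N" "c < N" using GD car by (auto simp: AB_mod_def)
      then show "mat N N (\<lambda>(r,c). sharp_gen n g $$ (2*r+1, 2*c+1)) $$ (r,c) = snd (AB_mod N ?\<delta> (LA_mat n) (LB_mat n)) g $$ (r,c)"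
        unfolding GD AB_mod_def sharp_gen_def using D[of r c] by simp
    qed (use GD car in \<open>auto simp: AB_mod_def\<close>)
  qed
  then show ?thesis
    unfolding Lodd_def N_def[symmetric] by (auto simp: prod_eq_iff fst_AB_mod)
qed

section \<open>Entries of A and their nonvanishing\<close>

lemma LA_up: "LA n j (Suc j) = (of_nat n - 2 * of_nat j - 1) * (of_nat n - 2 * of_nat j - 2) / 16"
  and LA_down: "LA n (Suc j) j = (2 * of_nat j + 3) * (2 * of_nat j + 2) / 16"
  and LA_diag: "LA n j j = ((of_nat n - 2 * of_nat j - 1) * (2 * of_nat j + 2)
       + (2 * of_nat j + 1) * (of_nat n - 2 * of_nat j) - 4) / 16"
  by (simp_all add: LA_def algebra_simps)

lemma LA_down_ne: "LA n (Suc j) j \<noteq> 0"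
proof -
  have "2 * of_nat j + 3 = (of_nat (2 * j + 3) :: complex)" "2 * of_nat j + 2 = (of_nat (2 * j + 2) :: complex)"
    by simp_all
  then show ?thesis unfolding LA_down by (simp del: of_nat_add of_nat_mult of_nat_Suc)
qed

lemma LA_up_ne:
  assumes "2 * j + 2 < n"
  shows "LA n j (Suc j) \<noteq> 0"
proof -
  have "of_nat n - 2 * of_nat j - 1 = (of_nat (n - 2 * j - 1) :: complex)"
    "of_nat n - 2 * of_nat j - 2 = (of_nat (n - 2 * j - 2) :: complex)"
    using assms by (simp_all add: of_nat_diff)
  then show ?thesis unfolding LA_up using assms by (simp del: of_nat_diff)
qed

lemma frac_cancel:
  fixes v :: complex
  assumes "v \<noteq> 0"
  shows "x / (k * v) * (y * v) = x * y / k"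
  using assms by simp

lemma LA_eq_0: "Suc i < j \<Longrightarrow> LA n i j = 0" "Suc j < i \<Longrightarrow> LA n i j = 0"
  by (auto simp: LA_def)

section \<open>The tridiagonal models for the residues of \<open>n\<close> mod 4\<close>

lemma of_int_odd_ne_0: "odd k \<Longrightarrow> of_int k \<noteq> (0::complex)"
  by auto

lemma off_cancel:
  fixes v :: complex
  assumes "v \<noteq> 0" "f = s * t * v / 4 * w" "TT = p * q * s * t / 16"
  shows "TT * w = p * q / (4 * v) * f"
  unfolding assms(2,3) using assms(1) by simp

lemma frac_cancel_last:
  fixes v :: complex
  assumes "v \<noteq> 0"
  shows "x / (k * v) * p * q * v = x / k * p * q"
  using assms by simp

text \<open>The last two factors of \<phi> at m - j are -(m - 2j - 2)/2 and -(m - 2j - 1)/2. They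
  cancel against the denominators, and only m - 2j remains in the formula for r. Similar
  cancellations give r in the other residue classes.\<close>

lemma racah_odd:
  fixes d :: nat
  defines "n \<equiv> 2 * d + 1"
  shows "racah_tridiagonal d (-1/4) (-1/4) (-1/4) (of_nat d + 1/2) (rev_mat (LA_mat n))
    (\<lambda>j. (of_nat d + 1/2 - of_nat j) * (-1/2 - of_nat j) / (4 * (of_nat d + 1/2 - 2 * of_nat j)))"
proof -
  let ?m = "of_nat d + 1/2 :: complex" and ?\<phi> = "Rphi d (-1/4) (-1/4) (-1/4)"
  have T: "rev_mat (LA_mat n) $$ (i,j) = LA n (d - i) (d - j)" if "i \<le> d" "j \<le> d" for i j
    using that by (auto simp: rev_mat_def LA_mat_def n_def)
  \<comment> \<open>Doubled, these numbers are the odd integers 2d + 1 - 4j, 2d - 1 - 4j and 2d + 3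
    - 4j.\<close>
  have par: "?m - 2 * of_nat j \<noteq> 0" "?m - 2 * of_nat j - 1 \<noteq> 0" "?m - 2 * of_nat j + 1 \<noteq> 0" for j
    using of_int_odd_ne_0[of "2 * int d + 1 - 4 * int j"] of_int_odd_ne_0[of "2 * int d - 1 - 4 * int j"]
      of_int_odd_ne_0[of "2 * int d + 3 - 4 * int j"] by (auto simp: field_simps)
  have phi: "?\<phi> j = (of_nat j * (of_nat j - of_nat d - 1) * (?m - 2 * of_nat j + 2) / 4) * (?m - 2 * of_nat j + 1)" for j
    by (simp add: Rphi_def field_simps)
  have rho: "?\<phi> (Suc j) / (?m - 2 * of_nat j - 1) = of_nat (Suc j) * (of_nat j - of_nat d) * (?m - 2 * of_nat j) / 4"
    "?\<phi> j / (?m - 2 * of_nat j + 1) = of_nat j * (of_nat j - of_nat d - 1) * (?m - 2 * of_nat j + 2) / 4" for j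
  proof -
    have e: "?m - 2 * of_nat (Suc j) + 1 = ?m - 2 * of_nat j - 1" "?m - 2 * of_nat (Suc j) + 2 = ?m - 2 * of_nat j"
      "of_nat (Suc j) - of_nat d - 1 = (of_nat j - of_nat d :: complex)"
      by simp_all
    show "?\<phi> (Suc j) / (?m - 2 * of_nat j - 1) = of_nat (Suc j) * (of_nat j - of_nat d) * (?m - 2 * of_nat j) / 4"
      unfolding phi[of "Suc j"] e by (rule nonzero_mult_div_cancel_right[OF par(2)])
    show "?\<phi> j / (?m - 2 * of_nat j + 1) = of_nat j * (of_nat j - of_nat d - 1) * (?m - 2 * of_nat j + 2) / 4"
      unfolding phi[of j] by (rule nonzero_mult_div_cancel_right[OF par(3)])
  qed
  show ?thesis
  proof
    show "rev_mat (LA_mat n) \<in> carrier_mat (d + 1) (d + 1)" by (simp add: rev_mat_def LA_mat_def n_def)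
    show "rev_mat (LA_mat n) $$ (i,j) = 0" if "i \<le> d" "j \<le> d" "Suc i < j \<or> Suc j < i" for i j
      using that by (auto simp: T LA_def)
    show "rev_mat (LA_mat n) $$ (j,j) = Rtheta d (-1/4) j + ?\<phi> (Suc j) / (?m - 2 * of_nat j - 1)
        - ?\<phi> j / (?m - 2 * of_nat j + 1)" if "j \<le> d" for j
      unfolding rho T[OF that that] using that
      by (simp add: LA_def Rtheta_def n_def of_nat_diff field_simps)
    fix j assume j: "j < d"
    have l: "d - j = Suc (d - Suc j)" using j by simp
    have up: "rev_mat (LA_mat n) $$ (j, Suc j) = (of_nat n - 2 * of_nat j) * (of_nat n - 2 * of_nat j - 1) / 16"
      using j by (simp add: T l) (simp add: LA_def n_def of_nat_diff field_simps)
    have down: "rev_mat (LA_mat n) $$ (Suc j, j) = (2 * of_nat j + 1) * (2 * of_nat j + 2) / 16"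
      using j by (simp add: T l) (simp add: LA_def n_def of_nat_diff field_simps)
    show "rev_mat (LA_mat n) $$ (j, Suc j) * rev_mat (LA_mat n) $$ (Suc j, j) * (?m - 2 * of_nat j - 1) =
      (?m - of_nat j) * (-1/2 - of_nat j) / (4 * (?m - 2 * of_nat j)) * ?\<phi> (Suc j)"
    proof -
      have "?\<phi> (Suc j) = of_nat (Suc j) * (of_nat j - of_nat d) * (?m - 2 * of_nat j) / 4 * (?m - 2 * of_nat j - 1)"
        using rho(1)[of j] par(2)[of j] by (simp add: nonzero_divide_eq_eq)
      moreover have "rev_mat (LA_mat n) $$ (j, Suc j) * rev_mat (LA_mat n) $$ (Suc j, j)
        = (?m - of_nat j) * (-1/2 - of_nat j) * of_nat (Suc j) * (of_nat j - of_nat d) / 16"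
        unfolding up down by (simp add: n_def field_simps)
      ultimately show ?thesis by (rule off_cancel[OF par(1)])
    qed
    show "(?m - of_nat j) * (-1/2 - of_nat j) / (4 * (?m - 2 * of_nat j)) * (?m - 2 * of_nat j - 2)
       * (?m - 2 * of_nat j - 1) * (?m - 2 * of_nat j) = Rphi_at d (-1/4) (-1/4) (-1/4) (?m - of_nat j)"
    proof -
      have "(?m - of_nat j) * (-1/2 - of_nat j) / (4 * (?m - 2 * of_nat j)) * (?m - 2 * of_nat j - 2)
       * (?m - 2 * of_nat j - 1) * (?m - 2 * of_nat j) = (?m - of_nat j) * (-1/2 - of_nat j) / 4 * (?m - 2 * of_nat j - 2)
       * (?m - 2 * of_nat j - 1)" by (rule frac_cancel_last[OF par(1)])
      also have "\<dots> = Rphi_at d (-1/4) (-1/4) (-1/4) (?m - of_nat j)"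
        by (simp add: Rphi_at_def field_simps)
      finally show ?thesis .
    qed
    have "of_nat n - 2 * of_nat j = (of_nat (n - 2 * j) :: complex)" "of_nat n - 2 * of_nat j - 1 = (of_nat (n - 2 * j - 1) :: complex)"
      using j by (simp_all add: n_def of_nat_diff)
    then show "rev_mat (LA_mat n) $$ (j, Suc j) \<noteq> 0" unfolding up using j by (simp add: n_def del: of_nat_diff)
    have "2 * of_nat j + 1 = (of_nat (2 * j + 1) :: complex)" "2 * of_nat j + 2 = (of_nat (2 * j + 2) :: complex)"
      by simp_all
    then show "rev_mat (LA_mat n) $$ (Suc j, j) \<noteq> 0" unfolding down by (simp del: of_nat_add of_nat_mult of_nat_Suc)
  next
    show "?m \<noteq> of_nat s" for s
      using of_int_odd_ne_0[of "2 * int d + 1 - 2 * int s"] by (auto simp: field_simps)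
    show "?m \<noteq> - 1"
      using of_int_odd_ne_0[of "2 * int d + 3"] by (auto simp: field_simps add_eq_0_iff2)
    \<comment> \<open>Vacuous, because m is not an integer.\<close>
    show "?\<phi> e / 12 + rev_mat (LA_mat n) $$ (e, e) + (?m - of_nat e) * (-1/2 - of_nat e) / (4 * (?m - 2 * of_nat e)) = Rtheta d (-1/4) d"
      if "?m = 2 * of_nat d" for e
      using that of_int_odd_ne_0[of "2 * int d + 1 - 4 * int d"] by (auto simp: field_simps)
  qed simp
qed

lemma Lodd_odd:
  fixes d :: nat
  shows "rmod_irreducible (Rmod d (-1/4) (-1/4) (-1/4)) \<and> rmod_iso (Lodd (2 * d + 1)) (Rmod d (-1/4) (-1/4) (-1/4))"
proof -
  let ?n = "2 * d + 1"
  interpret racah_tridiagonal d "-1/4" "-1/4" "-1/4" "of_nat d + 1/2" "rev_mat (LA_mat ?n)"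
    "\<lambda>j. (of_nat d + 1/2 - of_nat j) * (-1/2 - of_nat j) / (4 * (of_nat d + 1/2 - 2 * of_nat j))"
    by (rule racah_odd)
  have N: "(?n + 1) div 2 = d + 1" by simp
  have A: "LA_mat ?n \<in> carrier_mat (d+1) (d+1)" and B: "LB_mat ?n \<in> carrier_mat (d+1) (d+1)"
    by (simp_all add: LA_mat_def LB_mat_def)
  have Bd: "rev_mat (LB_mat ?n) = mat (d+1) (d+1) (\<lambda>(i,j). if i = j then Rtheta d (-1/4) i else 0)"
    by (intro eq_matI) (auto simp: rev_mat_def LB_mat_def LB_def Rtheta_def of_nat_diff power2_eq_square field_simps)
  have \<delta>: "(of_nat ?n * (of_nat ?n + 2) - 12) / 16 = Rdelta d (-1/4) (-1/4) (-1/4)"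
    by (simp add: Rdelta_def field_simps)
  have "rmod_iso (Lodd ?n) (AB_mod (d+1) (Rdelta d (-1/4) (-1/4) (-1/4)) (rev_mat (LA_mat ?n)) (rev_mat (LB_mat ?n)))"
    unfolding Lodd_eq_AB_mod N \<delta> by (rule AB_mod_iso_rev[OF A B])
  then have "rmod_iso (Lodd ?n) (Rmod d (-1/4) (-1/4) (-1/4))"
    using iso unfolding Bd
    by (rule rmod_iso_trans)
      (auto simp: Lodd_eq_AB_mod Rmod_eq_AB_mod rev_mat_def LA_mat_def LB_mat_def RmatA_def RmatB_def intro!: rmod_wf_AB_mod)
  then show ?thesis using irreducible by simp
qed

text \<open>Here N = 2d + 3 is odd and the middle vector, of index d + 1, is absent for \<epsilon> =
  -1. All mirror terms vanish, so folding merely cuts \<open>LA_mat n\<close> down to its first d +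
  1 rows and columns.\<close>

lemma racah_2_mod_4_minus:
  fixes d :: nat
  defines "n \<equiv> 4 * d + 6"
  shows "racah_tridiagonal d ((of_nat d + 1)/2) ((of_nat d + 1)/2) ((of_nat d + 1)/2) (2 * of_nat d + 2)
    (fold_mat (-1) (Suc d) (LA_mat n))
    (\<lambda>j. - (2 * of_nat d + 2 - of_nat j) * (of_nat j + 3/2) / (8 * (of_nat d - of_nat j)))"
proof -
  let ?a = "(of_nat d + 1)/2 :: complex" and ?m = "2 * of_nat d + 2 :: complex" and ?T = "fold_mat (-1) (Suc d) (LA_mat n)"
  let ?\<phi> = "Rphi d ?a ?a ?a"
  have N: "Suc n div 2 = 2 * d + 3" by (simp add: n_def)
  have T: "?T $$ (i,j) = LA n i j" if "i \<le> d" "j \<le> d" for i j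
    using that by (auto simp: fold_mat_def LA_mat_def N LA_eq_0)
  have par: "?m - 2 * of_nat j - 1 \<noteq> 0" "?m - 2 * of_nat j + 1 \<noteq> 0" for j
    using of_int_odd_ne_0[of "2 * int d + 1 - 2 * int j"] of_int_odd_ne_0[of "2 * int d + 3 - 2 * int j"]
    by (auto simp: field_simps)
  have phi: "?\<phi> j = of_nat j * (of_nat j - of_nat d - 1) * (2 * of_nat d + 7/2 - of_nat j) / 2 * (?m - 2 * of_nat j + 1)" for j
    by (simp add: Rphi_def field_simps)
  have rho: "?\<phi> (Suc j) / (?m - 2 * of_nat j - 1) = (of_nat j + 1) * (of_nat j - of_nat d) * (2 * of_nat d + 5/2 - of_nat j) / 2"
    "?\<phi> j / (?m - 2 * of_nat j + 1) = of_nat j * (of_nat j - of_nat d - 1) * (2 * of_nat d + 7/2 - of_nat j) / 2" for j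
    unfolding nonzero_divide_eq_eq[OF par(1)] nonzero_divide_eq_eq[OF par(2)] phi by (simp_all add: field_simps)
  show ?thesis
  proof
    show "?T \<in> carrier_mat (d+1) (d+1)" by (simp add: fold_mat_def)
    show "?T $$ (i,j) = 0" if "i \<le> d" "j \<le> d" "Suc i < j \<or> Suc j < i" for i j
      using that by (auto simp: T LA_eq_0)
    show "?T $$ (j,j) = Rtheta d ?a j + ?\<phi> (Suc j) / (?m - 2 * of_nat j - 1) - ?\<phi> j / (?m - 2 * of_nat j + 1)" if "j \<le> d" for j
      unfolding rho T[OF that that] by (simp add: LA_diag Rtheta_def n_def field_simps)
    fix j assume j: "j < d"
    then have v: "of_nat d - of_nat j \<noteq> (0::complex)" by simp
    show "?T $$ (j, Suc j) * ?T $$ (Suc j, j) * (?m - 2 * of_nat j - 1) =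
      - (2 * of_nat d + 2 - of_nat j) * (of_nat j + 3/2) / (8 * (of_nat d - of_nat j)) * ?\<phi> (Suc j)"
    proof -
      have "?\<phi> (Suc j) = - (of_nat j + 1) * (2 * of_nat d + 5/2 - of_nat j) * (of_nat d + 1/2 - of_nat j) * (of_nat d - of_nat j)"
        by (simp add: Rphi_def field_simps)
      moreover have "?T $$ (j, Suc j) * ?T $$ (Suc j, j) * (?m - 2 * of_nat j - 1) =
        - (2 * of_nat d + 2 - of_nat j) * (of_nat j + 3/2) *
        (- (of_nat j + 1) * (2 * of_nat d + 5/2 - of_nat j) * (of_nat d + 1/2 - of_nat j)) / 8"
        unfolding T[OF less_imp_le[OF j] Suc_leI[OF j]] T[OF Suc_leI[OF j] less_imp_le[OF j]] LA_up LA_down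
        by (simp add: n_def field_simps)
      ultimately show ?thesis by (simp only: frac_cancel[OF v])
    qed
    show "- (2 * of_nat d + 2 - of_nat j) * (of_nat j + 3/2) / (8 * (of_nat d - of_nat j)) * (?m - 2 * of_nat j - 2)
       * (?m - 2 * of_nat j - 1) * (?m - 2 * of_nat j) = Rphi_at d ?a ?a ?a (?m - of_nat j)"
    proof -
      have "?m - 2 * of_nat j - 2 = 2 * (of_nat d - of_nat j)" by (simp add: algebra_simps)
      then show ?thesis by (simp only: frac_cancel[OF v]) (simp add: Rphi_at_def field_simps)
    qed
    have "2 * j + 2 < n" using j by (simp add: n_def)
    then show "?T $$ (j, Suc j) \<noteq> 0" "?T $$ (Suc j, j) \<noteq> 0"
      using j LA_up_ne[of j n] LA_down_ne[of n j] by (auto simp: T)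
  next
    show "?m \<noteq> of_nat s" if "s < 2 * d" for s
    proof -
      have e: "?m = of_nat (2 * d + 2)" by simp
      show ?thesis unfolding e of_nat_eq_iff using that by simp
    qed
    show "?m \<noteq> -1"
    proof
      assume "?m = -1"
      have "of_nat (2 * d + 3) = ?m + 1" by simp
      also have "\<dots> = 0" unfolding \<open>?m = -1\<close> by simp
      finally show False unfolding of_nat_eq_0_iff by simp
    qed
    show "?\<phi> e / 12 + ?T $$ (e,e) + - (2 * of_nat d + 2 - of_nat e) * (of_nat e + 3/2) / (8 * (of_nat d - of_nat e)) = Rtheta d ?a d"
      if "?m = 2 * of_nat d" for e
      using that by simp
  qed (simp add: field_simps)
qed

text \<open>Now N = 2d + 1 and the middle vector, of index d, belongs to the eigenspace. Folding
  doubles the entry (d - 1, d), while in row d the weight 1/2 averages two equal neighbours. As m =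
  2d, the condition \<open>r\<close> reads 0 = 0 at j = d - 1; the factor 2 there is dictated by
  \<open>off\<close>.\<close>

lemma racah_2_mod_4_plus:
  fixes d :: nat
  defines "n \<equiv> 4 * d + 2"
  shows "racah_tridiagonal d (of_nat d/2) ((of_nat d - 1)/2) (of_nat d/2) (2 * of_nat d)
    (fold_mat 1 (Suc d) (LA_mat n))
    (\<lambda>j. (if Suc j = d then 2 else 1) * (- (2 * of_nat d - of_nat j) * (of_nat j + 3/2) / (8 * (of_nat d - of_nat j))))"
proof -
  let ?a = "of_nat d/2 :: complex" and ?b = "(of_nat d - 1)/2 :: complex" and ?m = "2 * of_nat d :: complex"
    and ?T = "fold_mat 1 (Suc d) (LA_mat n)"
  let ?\<phi> = "Rphi d ?a ?b ?a"
  have N: "Suc n div 2 = 2 * d + 1" by (simp add: n_def)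
  have Tent: "?T $$ (i,j) = (if i = d then 1/2 else 1) * (LA n i j + LA n i (2 * d - j))" if "i \<le> d" "j \<le> d" for i j
    using that by (auto simp: fold_mat_def LA_mat_def N)
  have Tdiag: "?T $$ (j,j) = LA n j j" if "j \<le> d" for j
    using that by (cases "j = d") (auto simp: Tent LA_eq_0)
  have Tup: "?T $$ (j, Suc j) = (if Suc j = d then 2 else 1) * LA n j (Suc j)" if "j < d" for j
    using that by (cases "Suc j = d") (auto simp: Tent LA_eq_0)
  have Tdown: "?T $$ (Suc j, j) = LA n (Suc j) j" if j: "j < d" for j
  proof (cases "Suc j = d")
    case True
    then have d: "d = Suc j" and e: "2 * d - j = Suc (Suc j)" by simp_all
    have "?T $$ (Suc j, j) = 1/2 * (LA n (Suc j) j + LA n (Suc j) (Suc (Suc j)))"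
      using Tent[of "Suc j" j, unfolded e] True by simp
    also have "\<dots> = LA n (Suc j) j" unfolding LA_up LA_down by (simp add: n_def d field_simps)
    finally show ?thesis .
  qed (use j in \<open>auto simp: Tent LA_eq_0\<close>)
  have par: "?m - 2 * of_nat j - 1 \<noteq> 0" "?m - 2 * of_nat j + 1 \<noteq> 0" for j
    using of_int_odd_ne_0[of "2 * int d - 1 - 2 * int j"] of_int_odd_ne_0[of "2 * int d + 1 - 2 * int j"]
    by (auto simp: field_simps)
  have phi: "?\<phi> j = of_nat j * (of_nat j - of_nat d - 1) * (2 * of_nat d + 3/2 - of_nat j) / 2 * (?m - 2 * of_nat j + 1)" for j
    by (simp add: Rphi_def field_simps)
  have rho: "?\<phi> (Suc j) / (?m - 2 * of_nat j - 1) = (of_nat j + 1) * (of_nat j - of_nat d) * (2 * of_nat d + 1/2 - of_nat j) / 2"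
    "?\<phi> j / (?m - 2 * of_nat j + 1) = of_nat j * (of_nat j - of_nat d - 1) * (2 * of_nat d + 3/2 - of_nat j) / 2" for j
    unfolding nonzero_divide_eq_eq[OF par(1)] nonzero_divide_eq_eq[OF par(2)] phi by (simp_all add: field_simps)
  show ?thesis
  proof
    show "?T \<in> carrier_mat (d+1) (d+1)" by (simp add: fold_mat_def)
    show "?T $$ (i,j) = 0" if "i \<le> d" "j \<le> d" "Suc i < j \<or> Suc j < i" for i j
      using that by (auto simp: Tent LA_eq_0)
    show "?T $$ (j,j) = Rtheta d ?a j + ?\<phi> (Suc j) / (?m - 2 * of_nat j - 1) - ?\<phi> j / (?m - 2 * of_nat j + 1)" if "j \<le> d" for j
      unfolding rho Tdiag[OF that] by (simp add: LA_diag Rtheta_def n_def field_simps)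
    fix j assume j: "j < d"
    then have v: "of_nat d - of_nat j \<noteq> (0::complex)" by simp
    define w where "w = (if Suc j = d then 2 else 1 :: complex)"
    show "?T $$ (j, Suc j) * ?T $$ (Suc j, j) * (?m - 2 * of_nat j - 1) =
      (if Suc j = d then 2 else 1) * (- (2 * of_nat d - of_nat j) * (of_nat j + 3/2) / (8 * (of_nat d - of_nat j))) * ?\<phi> (Suc j)"
    proof -
      have "?\<phi> (Suc j) = - (of_nat j + 1) * (2 * of_nat d + 1/2 - of_nat j) * (of_nat d - 1/2 - of_nat j) * (of_nat d - of_nat j)"
        by (simp add: Rphi_def field_simps)
      moreover have "LA n j (Suc j) * LA n (Suc j) j * (?m - 2 * of_nat j - 1) =
        - (2 * of_nat d - of_nat j) * (of_nat j + 3/2) *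
        (- (of_nat j + 1) * (2 * of_nat d + 1/2 - of_nat j) * (of_nat d - 1/2 - of_nat j)) / 8"
        unfolding LA_up LA_down by (simp add: n_def field_simps)
      ultimately show ?thesis unfolding w_def[symmetric] Tup[OF j] Tdown[OF j]
        by (simp only: frac_cancel[OF v] mult.assoc[of w])
    qed
    show "(if Suc j = d then 2 else 1) * (- (2 * of_nat d - of_nat j) * (of_nat j + 3/2) / (8 * (of_nat d - of_nat j)))
       * (?m - 2 * of_nat j - 2) * (?m - 2 * of_nat j - 1) * (?m - 2 * of_nat j) = Rphi_at d ?a ?b ?a (?m - of_nat j)"
    proof -
      \<comment> \<open>The weight differs from 1 only at j = d - 1, where m - 2j - 2 is
        zero.\<close>
      have w: "w * (?m - 2 * of_nat j - 2) = ?m - 2 * of_nat j - 2" by (auto simp: w_def)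
      have "w * x * (?m - 2 * of_nat j - 2) * (?m - 2 * of_nat j - 1) * (?m - 2 * of_nat j)
        = (x * (2 * (of_nat d - of_nat j))) * (w * (?m - 2 * of_nat j - 2)) * (?m - 2 * of_nat j - 1)" for x
        unfolding right_diff_distrib[of 2, symmetric] by (simp only: ac_simps)
      note this[unfolded w]
      then show ?thesis unfolding w_def[symmetric]
        by (simp only: frac_cancel[OF v]) (simp add: Rphi_at_def field_simps)
    qed
    have "2 * j + 2 < n" using j by (simp add: n_def)
    then show "?T $$ (j, Suc j) \<noteq> 0" "?T $$ (Suc j, j) \<noteq> 0"
      using j LA_up_ne[of j n] LA_down_ne[of n j] by (auto simp: Tup Tdown)
  next
    show "?m \<noteq> of_nat s" if "s < 2 * d" for s
    proof -
      have e: "?m = of_nat (2 * d)" by simp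
      show ?thesis unfolding e of_nat_eq_iff using that by simp
    qed
    show "?m \<noteq> -1"
    proof
      assume "?m = -1"
      have "of_nat (2 * d + 1) = ?m + 1" by simp
      also have "\<dots> = 0" unfolding \<open>?m = -1\<close> by simp
      finally show False unfolding of_nat_eq_0_iff by simp
    qed
    \<comment> \<open>With m = 2d this is the one model in which \<open>last\<close> has
      content.\<close>
    show "?\<phi> e / 12 + ?T $$ (e,e) + (if Suc e = d then 2 else 1) * (- (2 * of_nat d - of_nat e) * (of_nat e + 3/2) / (8 * (of_nat d - of_nat e))) = Rtheta d ?a d"
      if "d = Suc e" for e
    proof -
      have "e \<le> d" using that by simp
      from Tdiag[OF this] show ?thesis
        by (simp only:) (simp add: that LA_diag Rphi_def Rtheta_def n_def field_simps)
    qed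
  qed (simp add: field_simps)
qed

text \<open>N = 2d + 2 is even, so there is no middle vector: the flip exchanges the adjacent
  indices d and d + 1, and the entry between them falls on the last diagonal place with sign
  \<epsilon>. Only this entry of A tells the eigenspaces apart, and B has the same eigenvalues on
  both; in the parameters, a and c change places.\<close>

lemma fold_LA_mat_0_mod_4:
  fixes d :: nat
  defines "n \<equiv> 4 * d + 4"
  assumes "i \<le> d" "j \<le> d"
  shows "fold_mat \<epsilon> (Suc d) (LA_mat n) $$ (i,j) = LA n i j + (if i = d \<and> j = d then \<epsilon> * LA n d (Suc d) else 0)"
proof -
  have N: "Suc n div 2 = 2 * d + 2" by (simp add: n_def)
  have "Suc (2 * i) \<noteq> 2 * d + 2" by presburger
  then have "fold_mat \<epsilon> (Suc d) (LA_mat n) $$ (i,j) = LA n i j + \<epsilon> * LA n i (2 * d + 1 - j)"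
    using assms(2,3) by (auto simp: fold_mat_def LA_mat_def N)
  moreover have "LA n i (2 * d + 1 - j) = (if i = d \<and> j = d then LA n d (Suc d) else 0)"
    using assms(2,3) by (auto intro!: LA_eq_0(1))
  ultimately show ?thesis by auto
qed

lemma racah_0_mod_4_plus:
  fixes d :: nat
  defines "n \<equiv> 4 * d + 4"
  shows "racah_tridiagonal d ((of_nat d + 1)/2) (of_nat d/2) (of_nat d/2) (2 * of_nat d + 1)
    (fold_mat 1 (Suc d) (LA_mat n))
    (\<lambda>j. - (2 * of_nat d + 1 - of_nat j) * (of_nat j + 3/2) / (4 * (2 * of_nat d - 2 * of_nat j + 1)))"
proof -
  let ?a = "(of_nat d + 1)/2 :: complex" and ?b = "of_nat d/2 :: complex" and ?m = "2 * of_nat d + 1 :: complex"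
    and ?T = "fold_mat 1 (Suc d) (LA_mat n)"
  let ?\<phi> = "Rphi d ?a ?b ?b"
  note T = fold_LA_mat_0_mod_4[where \<epsilon>=1 and d=d, folded n_def]
  have Tup: "?T $$ (j, Suc j) = LA n j (Suc j)" and Tdown: "?T $$ (Suc j, j) = LA n (Suc j) j" if "j < d" for j
    using that by (auto simp: T)
  have phi: "?\<phi> j = - (of_nat j * (2 * of_nat d + 5/2 - of_nat j) * (of_nat d + 3/2 - of_nat j)) / 2 * (?m - 2 * of_nat j + 1)" for j
    by (simp add: Rphi_def field_simps)
  have rho: "?\<phi> j / (?m - 2 * of_nat j + 1) = - (of_nat j * (2 * of_nat d + 5/2 - of_nat j) * (of_nat d + 3/2 - of_nat j)) / 2" if "j \<le> d" for j
  proof -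
    have e: "?m - 2 * of_nat j + 1 = 2 * of_nat (Suc d - j)" using that by (simp add: of_nat_diff algebra_simps)
    have "?m - 2 * of_nat j + 1 \<noteq> 0" unfolding e mult_eq_0_iff of_nat_eq_0_iff using that by simp
    then show ?thesis unfolding phi by (rule nonzero_mult_div_cancel_right)
  qed
  \<comment> \<open>At j = d the denominator is zero and so is the quotient, whereas the cancelled
    polynomial would give \<open>- LA n d (Suc d)\<close>. The difference is exactly the entry that
    folding adds to the diagonal.\<close>
  have rho': "?\<phi> (Suc j) / (?m - 2 * of_nat j - 1) = (if j = d then 0 else - ((of_nat j + 1) * (2 * of_nat d + 3/2 - of_nat j) * (of_nat d + 1/2 - of_nat j)) / 2)" if "j \<le> d" for j
  proof (cases "j = d")
    case False
    have "?m - 2 * of_nat (Suc j) + 1 = ?m - 2 * of_nat j - 1" by simp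
    then show ?thesis using rho[of "Suc j"] False that by (simp add: algebra_simps)
  qed simp
  show ?thesis
  proof
    show "?T \<in> carrier_mat (d+1) (d+1)" by (simp add: fold_mat_def)
    show "?T $$ (i,j) = 0" if "i \<le> d" "j \<le> d" "Suc i < j \<or> Suc j < i" for i j
      using that by (auto simp: T LA_eq_0)
    show "?T $$ (j,j) = Rtheta d ?a j + ?\<phi> (Suc j) / (?m - 2 * of_nat j - 1) - ?\<phi> j / (?m - 2 * of_nat j + 1)" if "j \<le> d" for j
      unfolding rho[OF that] rho'[OF that] T[OF that that] by (simp add: LA_diag LA_up Rtheta_def n_def field_simps)
    fix j assume j: "j < d"
    have v: "2 * of_nat d - 2 * of_nat j + 1 \<noteq> (0::complex)"
      using of_int_odd_ne_0[of "2 * int d - 2 * int j + 1"] by simp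
    show "?T $$ (j, Suc j) * ?T $$ (Suc j, j) * (?m - 2 * of_nat j - 1) =
      - (2 * of_nat d + 1 - of_nat j) * (of_nat j + 3/2) / (4 * (2 * of_nat d - 2 * of_nat j + 1)) * ?\<phi> (Suc j)"
    proof -
      have "?\<phi> (Suc j) = (of_nat j + 1) * (of_nat j - of_nat d) * (2 * of_nat d + 3/2 - of_nat j) / 2 * (2 * of_nat d - 2 * of_nat j + 1)"
        by (simp add: Rphi_def field_simps)
      moreover have "LA n j (Suc j) * LA n (Suc j) j * (?m - 2 * of_nat j - 1) =
        - (2 * of_nat d + 1 - of_nat j) * (of_nat j + 3/2) *
        ((of_nat j + 1) * (of_nat j - of_nat d) * (2 * of_nat d + 3/2 - of_nat j) / 2) / 4"
        unfolding LA_up LA_down by (simp add: n_def field_simps)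
      ultimately show ?thesis using Tup[OF j] Tdown[OF j] by (simp only: frac_cancel[OF v])
    qed
    show "- (2 * of_nat d + 1 - of_nat j) * (of_nat j + 3/2) / (4 * (2 * of_nat d - 2 * of_nat j + 1)) * (?m - 2 * of_nat j - 2)
       * (?m - 2 * of_nat j - 1) * (?m - 2 * of_nat j) = Rphi_at d ?a ?b ?b (?m - of_nat j)"
    proof -
      have "?m - 2 * of_nat j = 2 * of_nat d - 2 * of_nat j + 1" by simp
      then show ?thesis by (simp only: frac_cancel_last[OF v]) (simp add: Rphi_at_def field_simps)
    qed
    have "2 * j + 2 < n" using j by (simp add: n_def)
    then show "?T $$ (j, Suc j) \<noteq> 0" "?T $$ (Suc j, j) \<noteq> 0"
      using j LA_up_ne[of j n] LA_down_ne[of n j] by (auto simp: T)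
  next
    show "?m \<noteq> of_nat s" if "s < 2 * d" for s
    proof -
      have e: "?m = of_nat (2 * d + 1)" by simp
      show ?thesis unfolding e of_nat_eq_iff using that by simp
    qed
    show "?m \<noteq> -1"
    proof
      assume "?m = -1"
      have "of_nat (2 * d + 2) = ?m + 1" by simp
      also have "\<dots> = 0" unfolding \<open>?m = -1\<close> by simp
      finally show False unfolding of_nat_eq_0_iff by simp
    qed
    show "?\<phi> e / 12 + ?T $$ (e,e) + - (2 * of_nat d + 1 - of_nat e) * (of_nat e + 3/2) / (4 * (2 * of_nat d - 2 * of_nat e + 1)) = Rtheta d ?a d"
      if "?m = 2 * of_nat d" for e
      using that by simp
  qed (simp add: field_simps)
qed

lemma racah_0_mod_4_minus:
  fixes d :: nat
  defines "n \<equiv> 4 * d + 4"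
  shows "racah_tridiagonal d (of_nat d/2) (of_nat d/2) ((of_nat d + 1)/2) (2 * of_nat d + 1)
    (fold_mat (-1) (Suc d) (LA_mat n))
    (\<lambda>j. - (2 * of_nat d + 1 - of_nat j) * (of_nat j + 3/2) / (4 * (2 * of_nat d - 2 * of_nat j - 1)))"
proof -
  let ?a = "of_nat d/2 :: complex" and ?c = "(of_nat d + 1)/2 :: complex" and ?m = "2 * of_nat d + 1 :: complex"
    and ?T = "fold_mat (-1) (Suc d) (LA_mat n)"
  let ?\<phi> = "Rphi d ?a ?a ?c"
  note T = fold_LA_mat_0_mod_4[where \<epsilon>="-1" and d=d, folded n_def]
  have Tup: "?T $$ (j, Suc j) = LA n j (Suc j)" and Tdown: "?T $$ (Suc j, j) = LA n (Suc j) j" if "j < d" for j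
    using that by (auto simp: T)
  have phi: "?\<phi> j = - (of_nat j * (2 * of_nat d + 5/2 - of_nat j) * (of_nat d + 1/2 - of_nat j)) / 2 * (?m - 2 * of_nat j + 1)" for j
    by (simp add: Rphi_def field_simps)
  have rho: "?\<phi> j / (?m - 2 * of_nat j + 1) = - (of_nat j * (2 * of_nat d + 5/2 - of_nat j) * (of_nat d + 1/2 - of_nat j)) / 2" if "j \<le> d" for j
  proof -
    have e: "?m - 2 * of_nat j + 1 = 2 * of_nat (Suc d - j)" using that by (simp add: of_nat_diff algebra_simps)
    have "?m - 2 * of_nat j + 1 \<noteq> 0" unfolding e mult_eq_0_iff of_nat_eq_0_iff using that by simp
    then show ?thesis unfolding phi by (rule nonzero_mult_div_cancel_right)
  qed
  \<comment> \<open>For \<epsilon> = -1 the polynomial would give \<open>LA n d (Suc d)\<close> at j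
    = d, and dropping it accounts for the entry that folding subtracts.\<close>
  have rho': "?\<phi> (Suc j) / (?m - 2 * of_nat j - 1) = (if j = d then 0 else - ((of_nat j + 1) * (2 * of_nat d + 3/2 - of_nat j) * (of_nat d - 1/2 - of_nat j)) / 2)" if "j \<le> d" for j
  proof (cases "j = d")
    case False
    have "?m - 2 * of_nat (Suc j) + 1 = ?m - 2 * of_nat j - 1" by simp
    then show ?thesis using rho[of "Suc j"] False that by (simp add: algebra_simps)
  qed simp
  show ?thesis
  proof
    show "?T \<in> carrier_mat (d+1) (d+1)" by (simp add: fold_mat_def)
    show "?T $$ (i,j) = 0" if "i \<le> d" "j \<le> d" "Suc i < j \<or> Suc j < i" for i j
      using that by (auto simp: T LA_eq_0)
    show "?T $$ (j,j) = Rtheta d ?a j + ?\<phi> (Suc j) / (?m - 2 * of_nat j - 1) - ?\<phi> j / (?m - 2 * of_nat j + 1)" if "j \<le> d" for j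
      unfolding rho[OF that] rho'[OF that] T[OF that that] by (simp add: LA_diag LA_up Rtheta_def n_def field_simps)
    fix j assume j: "j < d"
    have v: "2 * of_nat d - 2 * of_nat j - 1 \<noteq> (0::complex)"
      using of_int_odd_ne_0[of "2 * int d - 2 * int j - 1"] by simp
    show "?T $$ (j, Suc j) * ?T $$ (Suc j, j) * (?m - 2 * of_nat j - 1) =
      - (2 * of_nat d + 1 - of_nat j) * (of_nat j + 3/2) / (4 * (2 * of_nat d - 2 * of_nat j - 1)) * ?\<phi> (Suc j)"
    proof -
      have "?\<phi> (Suc j) = (of_nat j + 1) * (of_nat j - of_nat d) * (2 * of_nat d + 3/2 - of_nat j) / 2 * (2 * of_nat d - 2 * of_nat j - 1)"
        by (simp add: Rphi_def field_simps)
      moreover have "LA n j (Suc j) * LA n (Suc j) j * (?m - 2 * of_nat j - 1) =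
        - (2 * of_nat d + 1 - of_nat j) * (of_nat j + 3/2) *
        ((of_nat j + 1) * (of_nat j - of_nat d) * (2 * of_nat d + 3/2 - of_nat j) / 2) / 4"
        unfolding LA_up LA_down by (simp add: n_def field_simps)
      ultimately show ?thesis using Tup[OF j] Tdown[OF j] by (simp only: frac_cancel[OF v])
    qed
    show "- (2 * of_nat d + 1 - of_nat j) * (of_nat j + 3/2) / (4 * (2 * of_nat d - 2 * of_nat j - 1)) * (?m - 2 * of_nat j - 2)
       * (?m - 2 * of_nat j - 1) * (?m - 2 * of_nat j) = Rphi_at d ?a ?a ?c (?m - of_nat j)"
    proof -
      have "?m - 2 * of_nat j - 2 = 1 * (2 * of_nat d - 2 * of_nat j - 1)" by simp
      then show ?thesis by (simp only: frac_cancel[OF v]) (simp add: Rphi_at_def field_simps)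
    qed
    have "2 * j + 2 < n" using j by (simp add: n_def)
    then show "?T $$ (j, Suc j) \<noteq> 0" "?T $$ (Suc j, j) \<noteq> 0"
      using j LA_up_ne[of j n] LA_down_ne[of n j] by (auto simp: T)
  next
    show "?m \<noteq> of_nat s" if "s < 2 * d" for s
    proof -
      have e: "?m = of_nat (2 * d + 1)" by simp
      show ?thesis unfolding e of_nat_eq_iff using that by simp
    qed
    show "?m \<noteq> -1"
    proof
      assume "?m = -1"
      have "of_nat (2 * d + 2) = ?m + 1" by simp
      also have "\<dots> = 0" unfolding \<open>?m = -1\<close> by simp
      finally show False unfolding of_nat_eq_0_iff by simp
    qed
    show "?\<phi> e / 12 + ?T $$ (e,e) + - (2 * of_nat d + 1 - of_nat e) * (of_nat e + 3/2) / (4 * (2 * of_nat d - 2 * of_nat e - 1)) = Rtheta d ?a d"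
      if "?m = 2 * of_nat d" for e
      using that by simp
  qed (simp add: field_simps)
qed

section \<open>The decomposition\<close>

text \<open>The flip of v_i and v_(n-i) exchanges E and F and negates H, hence commutes with A and
  B, which involve only E + F and H^2. For even n it preserves the odd indices and sends 2r + 1 to
  2(N - 1 - r) + 1.\<close>

lemma centrosymmetric_L:
  assumes "even n"
  shows "centrosymmetric (LA_mat n)" "centrosymmetric (LB_mat n)"
proof -
  define N where "N = Suc n div 2"
  have n: "n = 2 * N" using assms by (simp add: N_def)
  have "LA n (N - 1 - i) (N - 1 - j) = LA n i j" if "i < N" "j < N" for i j
  proof -
    consider "j = Suc i" | "j = i" | "i = Suc j" | "Suc i < j \<or> Suc j < i" by linarith
    then show ?thesis
    proof cases
      case 1
      then have "N - 1 - i = Suc (N - 1 - j)" using that by simp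
      then show ?thesis using 1 that by (simp only: LA_up LA_down) (simp add: n of_nat_diff field_simps)
    next
      case 2
      then show ?thesis using that by (simp add: LA_diag n of_nat_diff field_simps)
    next
      case 3
      then have "N - 1 - j = Suc (N - 1 - i)" using that by simp
      then show ?thesis using 3 that by (simp only: LA_up LA_down) (simp add: n of_nat_diff field_simps)
    next
      case 4
      then have "Suc (N - 1 - i) < N - 1 - j \<or> Suc (N - 1 - j) < N - 1 - i" using that by linarith
      then show ?thesis using 4 by (auto simp: LA_eq_0)
    qed
  qed
  then show "centrosymmetric (LA_mat n)"
    by (auto simp: centrosymmetric_def LA_mat_def N_def)
  have "LB n (N - 1 - i) = LB n i" if "i < N" for i
    using that by (simp add: LB_def n of_nat_diff power2_eq_square field_simps)
  then show "centrosymmetric (LB_mat n)"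
    by (auto simp: centrosymmetric_def LB_mat_def N_def)
qed

lemma flip_index:
  fixes N :: nat
  assumes "2 * Suc d \<le> N + 1" "i < Suc d" "j < Suc d" "j < N"
  shows "i = N - 1 - j \<longleftrightarrow> i = j \<and> 2 * i + 1 = N"
  using assms by auto

lemma Lodd_even_iso:
  assumes n: "even n" and h: "half_dim \<epsilon> (n div 2) (Suc d1)" "half_dim (-\<epsilon>) (n div 2) (Suc d2)"
    and rac: "racah_tridiagonal d1 a1 b1 c1 m1 (fold_mat \<epsilon> (Suc d1) (LA_mat n)) r1"
      "racah_tridiagonal d2 a2 b2 c2 m2 (fold_mat (-\<epsilon>) (Suc d2) (LA_mat n)) r2"
    and \<delta>: "(of_nat n * (of_nat n + 2) - 12) / 16 = Rdelta d1 a1 b1 c1"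
      "(of_nat n * (of_nat n + 2) - 12) / 16 = Rdelta d2 a2 b2 c2"
    and B: "\<And>i. i \<le> d1 \<Longrightarrow> LB n i = Rtheta d1 b1 i" "\<And>i. i \<le> d2 \<Longrightarrow> LB n i = Rtheta d2 b2 i"
  shows "rmod_irreducible (Rmod d1 a1 b1 c1)" "rmod_irreducible (Rmod d2 a2 b2 c2)"
    "rmod_iso (Lodd n) (rmod_dsum (Rmod d1 a1 b1 c1) (Rmod d2 a2 b2 c2))"
proof -
  let ?\<delta> = "(of_nat n * (of_nat n + 2) - 12) / 16 :: complex" and ?N = "n div 2"
  interpret R1: racah_tridiagonal d1 a1 b1 c1 m1 "fold_mat \<epsilon> (Suc d1) (LA_mat n)" r1 by (rule rac)
  interpret R2: racah_tridiagonal d2 a2 b2 c2 m2 "fold_mat (-\<epsilon>) (Suc d2) (LA_mat n)" r2 by (rule rac)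
  show "rmod_irreducible (Rmod d1 a1 b1 c1)" "rmod_irreducible (Rmod d2 a2 b2 c2)"
    by (rule R1.irreducible, rule R2.irreducible)
  have N: "(n + 1) div 2 = ?N" using n by presburger
  have carL: "LA_mat n \<in> carrier_mat ?N ?N" "LB_mat n \<in> carrier_mat ?N ?N"
    unfolding LA_mat_def LB_mat_def N by simp_all
  have fold_LB: "fold_mat \<epsilon>' (Suc d) (LB_mat n) = mat (d+1) (d+1) (\<lambda>(i,j). if i = j then LB n i else 0)"
    if "half_dim \<epsilon>' ?N (Suc d)" for \<epsilon>' d
  proof (rule eq_matI)
    fix i j assume "i < dim_row (mat (d+1) (d+1) (\<lambda>(i,j). if i = j then LB n i else 0))"
      and "j < dim_col (mat (d+1) (d+1) (\<lambda>(i,j). if i = j then LB n i else 0))"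
    then have ij: "i < Suc d" "j < Suc d" by auto
    then have lt: "i < ?N" "j < ?N" using that by (auto simp: half_dim_def)
    have "fold_mat \<epsilon>' (Suc d) (LB_mat n) $$ (i,j) = (if 2*i+1 = ?N then 1/2 else 1) *
      ((if i = j then LB n i else 0) + \<epsilon>' * (if i = ?N - 1 - j then LB n i else 0))"
      using ij lt unfolding fold_mat_def LB_mat_def N by simp
    \<comment> \<open>The mirror term enters only at the middle index. There the sign is 1, and the
      weight 1/2 undoes the doubling.\<close>
    moreover have "i = ?N - 1 - j \<longleftrightarrow> i = j \<and> 2*i+1 = ?N"
    proof -
      have "2 * Suc d \<le> ?N + 1" using that by (auto simp: half_dim_def)
      then show ?thesis using ij lt(2) by (rule flip_index)
    qed
    moreover have "2*i+1 = ?N \<Longrightarrow> \<epsilon>' = 1" using that ij by (auto simp: half_dim_def)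
    ultimately show "fold_mat \<epsilon>' (Suc d) (LB_mat n) $$ (i,j) =
      mat (d+1) (d+1) (\<lambda>(i,j). if i = j then LB n i else 0) $$ (i,j)" using ij by auto
  qed (auto simp: fold_mat_def)
  have B1: "fold_mat \<epsilon> (Suc d1) (LB_mat n) = mat (d1+1) (d1+1) (\<lambda>(i,j). if i = j then Rtheta d1 b1 i else 0)"
    unfolding fold_LB[OF h(1)] using B(1) by (intro eq_matI) auto
  have B2: "fold_mat (-\<epsilon>) (Suc d2) (LB_mat n) = mat (d2+1) (d2+1) (\<lambda>(i,j). if i = j then Rtheta d2 b2 i else 0)"
    unfolding fold_LB[OF h(2)] using B(2) by (intro eq_matI) auto
  have split: "rmod_iso (Lodd n)
    (rmod_dsum (AB_mod (Suc d1) ?\<delta> (fold_mat \<epsilon> (Suc d1) (LA_mat n)) (fold_mat \<epsilon> (Suc d1) (LB_mat n)))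
      (AB_mod (Suc d2) ?\<delta> (fold_mat (-\<epsilon>) (Suc d2) (LA_mat n)) (fold_mat (-\<epsilon>) (Suc d2) (LB_mat n))))"
    unfolding Lodd_eq_AB_mod N by (rule centrosymmetric_iso_dsum[OF carL centrosymmetric_L[OF n] h])
  have iso1: "rmod_iso (AB_mod (Suc d1) ?\<delta> (fold_mat \<epsilon> (Suc d1) (LA_mat n)) (fold_mat \<epsilon> (Suc d1) (LB_mat n))) (Rmod d1 a1 b1 c1)"
    using R1.iso unfolding B1 \<delta>(1) by simp
  have iso2: "rmod_iso (AB_mod (Suc d2) ?\<delta> (fold_mat (-\<epsilon>) (Suc d2) (LA_mat n)) (fold_mat (-\<epsilon>) (Suc d2) (LB_mat n))) (Rmod d2 a2 b2 c2)"
    using R2.iso unfolding B2 \<delta>(2) by simp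
  have wfL: "rmod_wf (Lodd n)" unfolding Lodd_eq_AB_mod N using carL by (rule rmod_wf_AB_mod)
  have wfR: "rmod_wf (Rmod d a b c)" for d a b c
    unfolding Rmod_eq_AB_mod by (intro rmod_wf_AB_mod) (simp_all add: RmatA_def RmatB_def)
  have wfF: "rmod_wf (AB_mod (Suc d) \<delta>' (fold_mat \<epsilon>' (Suc d) X) (fold_mat \<epsilon>' (Suc d) Y))" for d \<delta>' \<epsilon>' X Y
    by (intro rmod_wf_AB_mod) (simp_all add: fold_mat_def)
  show "rmod_iso (Lodd n) (rmod_dsum (Rmod d1 a1 b1 c1) (Rmod d2 a2 b2 c2))"
    by (rule rmod_iso_trans[OF split rmod_iso_dsum[OF iso1 iso2]]) (intro rmod_wf_dsum wfL wfR wfF)+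
qed

text \<open>Only v_1 is present and the flip fixes it. The (-1)-eigenspace is zero, so the first
  summand of the general case disappears.\<close>

lemma Lodd_2:
  "rmod_irreducible (Rmod 0 0 (-1/2) 0) \<and> rmod_iso (Lodd 2) (Rmod 0 0 (-1/2) 0)"
proof -
  interpret racah_tridiagonal 0 0 "-1/2" 0 0 "LA_mat 2" "\<lambda>j. 0"
    by standard (auto simp: LA_mat_def LA_def Rtheta_def Rphi_def)
  have "LB_mat 2 = mat (0+1) (0+1) (\<lambda>(i,j). if i = j then Rtheta 0 (-1/2) i else 0)"
    by (intro eq_matI) (auto simp: LB_mat_def LB_def Rtheta_def)
  moreover have "(of_nat 2 * (of_nat 2 + 2) - 12) / 16 = Rdelta 0 0 (-1/2) 0"
    by (simp add: Rdelta_def)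
  moreover have "(2 + 1) div 2 = (0 + 1 :: nat)" by simp
  ultimately have "rmod_iso (Lodd 2) (Rmod 0 0 (-1/2) 0)"
    using iso by (simp only: Lodd_eq_AB_mod)
  then show ?thesis using irreducible by simp
qed

lemma Lodd_2_mod_4:
  fixes d :: nat
  defines "n \<equiv> 4 * d + 6"
  defines "h \<equiv> (of_nat d + 1)/2 :: complex"
  shows "rmod_irreducible (Rmod d h h h)" "rmod_irreducible (Rmod (Suc d) h (of_nat d/2) h)"
    "rmod_iso (Lodd n) (rmod_dsum (Rmod d h h h) (Rmod (Suc d) h (of_nat d/2) h))"
proof -
  have r1: "racah_tridiagonal d h h h (2 * of_nat d + 2) (fold_mat (-1) (Suc d) (LA_mat n))
    (\<lambda>j. - (2 * of_nat d + 2 - of_nat j) * (of_nat j + 3/2) / (8 * (of_nat d - of_nat j)))"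
    unfolding n_def h_def by (rule racah_2_mod_4_minus)
  \<comment> \<open>The middle vector makes the (+1)-eigenspace larger by one dimension, hence
    \<open>Suc d\<close>.\<close>
  have e: "4 * Suc d + 2 = n" "of_nat (Suc d) / 2 = h" "(of_nat (Suc d) - 1) / 2 = of_nat d / (2::complex)"
    by (simp_all add: n_def h_def)
  note r2 = racah_2_mod_4_plus[of "Suc d", unfolded e]
  have hd: "half_dim (-1) (n div 2) (Suc d)" "half_dim 1 (n div 2) (Suc (Suc d))"
    by (auto simp: half_dim_def n_def)
  have \<delta>: "(of_nat n * (of_nat n + 2) - 12) / 16 = Rdelta d h h h"
    "(of_nat n * (of_nat n + 2) - 12) / 16 = Rdelta (Suc d) h (of_nat d/2) h"
    by (simp_all add: Rdelta_def n_def h_def field_simps)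
  have B: "LB n i = Rtheta d h i" "LB n i = Rtheta (Suc d) (of_nat d/2) i" for i
    by (simp_all add: LB_def Rtheta_def n_def h_def power2_eq_square field_simps)
  have "even n" by (simp add: n_def)
  from Lodd_even_iso[where \<epsilon>="-1", unfolded minus_minus, OF this hd r1 r2 \<delta> B]
  show "rmod_irreducible (Rmod d h h h)" "rmod_irreducible (Rmod (Suc d) h (of_nat d/2) h)"
    "rmod_iso (Lodd n) (rmod_dsum (Rmod d h h h) (Rmod (Suc d) h (of_nat d/2) h))" .
qed

lemma Lodd_0_mod_4:
  fixes d :: nat
  defines "n \<equiv> 4 * d + 4"
  defines "h \<equiv> (of_nat d + 1)/2 :: complex" and "l \<equiv> of_nat d/2 :: complex"
  shows "rmod_irreducible (Rmod d h l l)" "rmod_irreducible (Rmod d l l h)"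
    "rmod_iso (Lodd n) (rmod_dsum (Rmod d h l l) (Rmod d l l h))"
proof -
  have hd: "half_dim 1 (n div 2) (Suc d)" "half_dim (-1) (n div 2) (Suc d)"
    by (auto simp: half_dim_def n_def)
  have \<delta>: "(of_nat n * (of_nat n + 2) - 12) / 16 = Rdelta d h l l"
    "(of_nat n * (of_nat n + 2) - 12) / 16 = Rdelta d l l h"
    by (simp_all add: Rdelta_def n_def h_def l_def field_simps)
  have B: "LB n i = Rtheta d l i" for i
    by (simp add: LB_def Rtheta_def n_def l_def power2_eq_square field_simps)
  have "even n" by (simp add: n_def)
  from Lodd_even_iso[OF this hd racah_0_mod_4_plus[of d, folded n_def h_def l_def]
    racah_0_mod_4_minus[of d, folded n_def h_def l_def] \<delta> B B]
  show "rmod_irreducible (Rmod d h l l)" "rmod_irreducible (Rmod d l l h)"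
    "rmod_iso (Lodd n) (rmod_dsum (Rmod d h l l) (Rmod d l l h))" .
qed

theorem theorem7p6:
  fixes n :: nat
  assumes "n \<ge> 1"
  shows
   "(odd n \<longrightarrow>
       rmod_irreducible (Rmod ((n - 1) div 2) (-1/4) (-1/4) (-1/4)) \<and>
       rmod_iso (Lodd n) (Rmod ((n - 1) div 2) (-1/4) (-1/4) (-1/4))) \<and>
    (n = 2 \<longrightarrow>
       rmod_irreducible (Rmod 0 0 (-1/2) 0) \<and>
       rmod_iso (Lodd n) (Rmod 0 0 (-1/2) 0)) \<and>
    (n \<noteq> 2 \<and> n mod 4 = 2 \<longrightarrow>
       rmod_irreducible (Rmod ((n - 6) div 4) ((of_nat n - 2)/8) ((of_nat n - 2)/8) ((of_nat n - 2)/8)) \<and>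
       rmod_irreducible (Rmod ((n - 2) div 4) ((of_nat n - 2)/8) ((of_nat n - 6)/8) ((of_nat n - 2)/8)) \<and>
       rmod_iso (Lodd n)
         (rmod_dsum (Rmod ((n - 6) div 4) ((of_nat n - 2)/8) ((of_nat n - 2)/8) ((of_nat n - 2)/8))
                    (Rmod ((n - 2) div 4) ((of_nat n - 2)/8) ((of_nat n - 6)/8) ((of_nat n - 2)/8)))) \<and>
    (n mod 4 = 0 \<longrightarrow>
       rmod_irreducible (Rmod (n div 4 - 1) (of_nat n / 8) ((of_nat n - 4)/8) ((of_nat n - 4)/8)) \<and>
       rmod_irreducible (Rmod (n div 4 - 1) ((of_nat n - 4)/8) ((of_nat n - 4)/8) (of_nat n / 8)) \<and>
       rmod_iso (Lodd n)
         (rmod_dsum (Rmod (n div 4 - 1) (of_nat n / 8) ((of_nat n - 4)/8) ((of_nat n - 4)/8))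
                    (Rmod (n div 4 - 1) ((of_nat n - 4)/8) ((of_nat n - 4)/8) (of_nat n / 8))))"
proof (intro conjI[of "odd n \<longrightarrow> _"] conjI[of "n = 2 \<longrightarrow> _"] conjI[of "n \<noteq> 2 \<and> n mod 4 = 2 \<longrightarrow> _"] impI)
  assume "odd n"
  then obtain d where n: "n = 2 * d + 1" by (elim oddE)
  then have "(n - 1) div 2 = d" by simp
  then show "rmod_irreducible (Rmod ((n - 1) div 2) (-1/4) (-1/4) (-1/4)) \<and>
       rmod_iso (Lodd n) (Rmod ((n - 1) div 2) (-1/4) (-1/4) (-1/4))"
    using Lodd_odd[of d] unfolding n by simp
next
  assume "n = 2"
  then show "rmod_irreducible (Rmod 0 0 (-1/2) 0) \<and> rmod_iso (Lodd n) (Rmod 0 0 (-1/2) 0)"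
    using Lodd_2 by simp
next
  assume a: "n \<noteq> 2 \<and> n mod 4 = 2"
  \<comment> \<open>Excluding n = 2 leaves n \<ge> 6, so the subtraction is not truncated.\<close>
  define d where "d = n div 4 - 1"
  have n: "n = 4 * d + 6" using a unfolding d_def by presburger
  then have e: "(n - 6) div 4 = d" "(n - 2) div 4 = Suc d" "(of_nat n - 2)/8 = (of_nat d + 1)/(2::complex)"
    "(of_nat n - 6)/8 = of_nat d/(2::complex)" by (simp_all add: field_simps)
  show "rmod_irreducible (Rmod ((n - 6) div 4) ((of_nat n - 2)/8) ((of_nat n - 2)/8) ((of_nat n - 2)/8)) \<and>
       rmod_irreducible (Rmod ((n - 2) div 4) ((of_nat n - 2)/8) ((of_nat n - 6)/8) ((of_nat n - 2)/8)) \<and>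
       rmod_iso (Lodd n)
         (rmod_dsum (Rmod ((n - 6) div 4) ((of_nat n - 2)/8) ((of_nat n - 2)/8) ((of_nat n - 2)/8))
                    (Rmod ((n - 2) div 4) ((of_nat n - 2)/8) ((of_nat n - 6)/8) ((of_nat n - 2)/8)))"
    unfolding e using Lodd_2_mod_4[of d] unfolding n[symmetric] by blast
next
  assume a: "n mod 4 = 0"
  \<comment> \<open>Positivity of n gives n \<ge> 4, so again nothing is truncated.\<close>
  define d where "d = n div 4 - 1"
  have n: "n = 4 * d + 4" using a assms unfolding d_def by presburger
  then have e: "n div 4 - 1 = d" "of_nat n / 8 = (of_nat d + 1)/(2::complex)"
    "(of_nat n - 4)/8 = of_nat d/(2::complex)" by (simp_all add: field_simps)
  show "rmod_irreducible (Rmod (n div 4 - 1) (of_nat n / 8) ((of_nat n - 4)/8) ((of_nat n - 4)/8)) \<and>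
       rmod_irreducible (Rmod (n div 4 - 1) ((of_nat n - 4)/8) ((of_nat n - 4)/8) (of_nat n / 8)) \<and>
       rmod_iso (Lodd n)
         (rmod_dsum (Rmod (n div 4 - 1) (of_nat n / 8) ((of_nat n - 4)/8) ((of_nat n - 4)/8))
                    (Rmod (n div 4 - 1) ((of_nat n - 4)/8) ((of_nat n - 4)/8) (of_nat n / 8)))"
    unfolding e using Lodd_0_mod_4[of d] unfolding n[symmetric] by blast
qed

end
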